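(* Let $K=K(N)$, $N\ge3$, be a sequence of integers with $N/2<K(N)<N$, and set $P=\min(2K-N,N-K)$. If $P\to\infty$ as $N\to\infty$, then for every $\varepsilon\in(0,1)$ there exists $C_\varepsilon>0$ such that for all $N$, $$\frac{K^2}{8\pi^2}\log P-C_\varepsilon K^2\le\tau^{\mathrm{FEP}}_{\mathcal E_{N,K}}(\varepsilon),$$ where $\tau^{\mathrm{FEP}}_{\mathcal E_{N,K}}(\varepsilon)$ is the $\varepsilon$-mixing time of the Facilitated Exclusion Process started from its ergodic component.
   Context: For an integer $N$ let $\mathbb T_N=\mathbb Z/N\mathbb Z$, with elements written $1,\dots,N$. For integers $N/2<K<N$ let $\Gamma_{N,K}=\{\eta\in\{0,1\}^{\mathbb T_N}:\sum_x\eta_x=K\}$. The Facilitated Exclusion Process (FEP) is the continuous-time Markov chain $(\eta(t))_{t\ge0}$ on $\Gamma_{N,K}$ with generator $$\mathcal L f(\eta)=\sum_{x\in\mathbb T_N}\sum_{z=\pm1}\eta_x\eta_{x-z}(1-\eta_{x+z})\big(f(\eta^{x,x+z})-f(\eta)\big),$$ where $\eta^{x,y}$ is obtained from $\eta$ by exchanging the values at sites $x$ and $y$. Write $\mathbb P_\eta$ for its law started from $\eta$. The ergodic component is $\mathcal E_{N,K}=\{\eta\in\Gamma_{N,K}:\eta_x+\eta_{x+1}\ge1\ \forall x\in\mathbb T_N\}$ and $\pi^{\mathrm{FEP}}_{N,K}$ is the uniform probability measure on $\mathcal E_{N,K}$. With $d_{\mathrm{TV}}$ the total variation distance, $$\tau^{\mathrm{FEP}}_{\mathcal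 E_{N,K}}(\varepsilon)=\inf\{t\ge0:\forall\eta\in\mathcal E_{N,K},\ d_{\mathrm{TV}}(\mathbb P_\eta(\eta(t)\in\cdot),\pi^{\mathrm{FEP}}_{N,K})\le\varepsilon\}.$$ *)

theory Defs
  imports "HOL-Probability.Probability"
begin

section \<open>Configurations\<close>

text \<open>
  The discrete torus of size \<open>N\<close> is represented by the residues \<open>0, \<dots>, N - 1\<close>, the
  site written \<open>N\<close> in the usual labelling \<open>1, \<dots>, N\<close> being \<open>0\<close>. Arithmetic on sites is always
  followed by \<open>mod N\<close>. Configurations are extensional functions, so that their sets are finite.
\<close>

type_synonym config = "int \<Rightarrow> nat"

definition torus :: "nat \<Rightarrow> int set" where
  "torus N = {0..<int N}"

definition configs :: "nat \<Rightarrow> nat \<Rightarrow> config set" where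
  "configs N K = {\<eta> \<in> torus N \<rightarrow>\<^sub>E {0, 1}. (\<Sum>x\<in>torus N. \<eta> x) = K}"

definition ergodic :: "nat \<Rightarrow> nat \<Rightarrow> config set" where
  "ergodic N K = {\<eta> \<in> configs N K. \<forall>x\<in>torus N. \<eta> x + \<eta> ((x + 1) mod int N) \<ge> 1}"

definition exchange :: "config \<Rightarrow> int \<Rightarrow> int \<Rightarrow> config" where
  "exchange \<eta> x y = \<eta>(x := \<eta> y, y := \<eta> x)"


section \<open>The Facilitated Exclusion Process\<close>

definition fep_generator :: "nat \<Rightarrow> (config \<Rightarrow> real) \<Rightarrow> config \<Rightarrow> real" where
  "fep_generator N f \<eta> =
     (\<Sum>x\<in>torus N. \<Sum>z\<in>{1, -1}.
        real (\<eta> x) * real (\<eta> ((x - z) mod int N)) * (1 - real (\<eta> ((x + z) mod int N)))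
          * (f (exchange \<eta> x ((x + z) mod int N)) - f \<eta>))"

text \<open>
  The Markov semigroup \<open>exp (t L)\<close> generated by the operator \<open>L\<close>. For the finite-state chain
  with generator \<open>L\<close>, \<open>semigroup L t f \<eta>\<close> is the expectation of \<open>f\<close> at time \<open>t\<close> when the
  chain starts from \<open>\<eta>\<close>.
\<close>

definition semigroup :: "(('a \<Rightarrow> real) \<Rightarrow> 'a \<Rightarrow> real) \<Rightarrow> real \<Rightarrow> ('a \<Rightarrow> real) \<Rightarrow> 'a \<Rightarrow> real" where
  "semigroup L t f \<eta> = (\<Sum>n. t ^ n / fact n * (L ^^ n) f \<eta>)"

text \<open>
  The law at time \<open>t\<close> of the process started from \<open>\<eta>\<close>. That the transition probabilities below
  do form a probability mass function is the lemma \<open>pmf_fep_law\<close>.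
\<close>

definition fep_law :: "nat \<Rightarrow> config \<Rightarrow> real \<Rightarrow> config pmf" where
  "fep_law N \<eta> t = embed_pmf (\<lambda>\<xi>. semigroup (fep_generator N) t (indicator {\<xi>}) \<eta>)"

definition fep_stationary :: "nat \<Rightarrow> nat \<Rightarrow> config pmf" where
  "fep_stationary N K = pmf_of_set (ergodic N K)"

definition tv_dist :: "'a pmf \<Rightarrow> 'a pmf \<Rightarrow> real" where
  "tv_dist p q = (SUP A. \<bar>measure_pmf.prob p A - measure_pmf.prob q A\<bar>)"

text \<open>
  The mixing time is extended-real valued only so that the infimum of the empty set is \<open>\<infinity>\<close>.
\<close>

definition fep_mixing_time :: "nat \<Rightarrow> nat \<Rightarrow> real \<Rightarrow> ereal" where
  "fep_mixing_time N K \<epsilon> =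
     Inf (ereal ` {t. t \<ge> 0 \<and>
       (\<forall>\<eta>\<in>ergodic N K. tv_dist (fep_law N \<eta> t) (fep_stationary N K) \<le> \<epsilon>)})"


section \<open>Well-definedness\<close>

lemma finite_configs: "finite (configs N K)"
proof (rule finite_subset)
  show "configs N K \<subseteq> torus N \<rightarrow>\<^sub>E {0, 1}" by (auto simp: configs_def)
  show "finite (torus N \<rightarrow>\<^sub>E ({0, 1} :: nat set))" by (intro finite_PiE) (auto simp: torus_def)
qed

lemma finite_ergodic: "finite (ergodic N K)"
  by (rule finite_subset[OF _ finite_configs[of N K]]) (auto simp: ergodic_def)

lemma ergodic_nonempty:
  assumes "N < 2 * K" "K < N"
  shows "ergodic N K \<noteq> {}"
proof -
  define Z where "Z = (\<lambda>i. 2 * int i + 1) ` {..<N - K}"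
  have Zsub: "Z \<subseteq> torus N" using assms by (auto simp: Z_def torus_def)
  have "card Z = N - K" unfolding Z_def by (subst card_image) (auto simp: inj_on_def)
  have odd: "odd x" "x < int N - 1" if "x \<in> Z" for x using that assms by (auto simp: Z_def)
  define \<eta> :: config where "\<eta> = restrict (\<lambda>x. if x \<in> Z then 0 else 1) (torus N)"
  have "(\<Sum>x\<in>torus N. \<eta> x) = (\<Sum>x\<in>torus N. if x \<in> Z then 0 else 1)"
    by (auto simp: \<eta>_def intro!: sum.cong)
  also have "\<dots> = card (torus N - Z)"
    by (subst sum.If_cases) (auto simp: torus_def Diff_eq)
  also have "\<dots> = K"
    using \<open>card Z = N - K\<close> Zsub assms by (subst card_Diff_subset) (auto simp: torus_def intro: finite_subset)
  finally have "\<eta> \<in> configs N K" by (auto simp: configs_def \<eta>_def)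
  moreover have "\<eta> x + \<eta> ((x + 1) mod int N) \<ge> 1" if x: "x \<in> torus N" for x
  proof (cases "x \<in> Z")
    case True
    hence "(x + 1) mod int N = x + 1"
      using x odd(2)[OF True] by (auto simp: torus_def intro!: mod_pos_pos_trivial)
    moreover have "x + 1 \<notin> Z" using odd(1)[OF True] odd(1)[of "x + 1"] by auto
    moreover have "x + 1 \<in> torus N" using x odd(2)[OF True] by (auto simp: torus_def)
    ultimately show ?thesis by (simp add: \<eta>_def)
  qed (use x in \<open>auto simp: \<eta>_def\<close>)
  ultimately show ?thesis by (auto simp: ergodic_def)
qed

locale jump_generator =
  fixes L :: "('a \<Rightarrow> real) \<Rightarrow> 'a \<Rightarrow> real" and S :: "'a set"
    and I :: "'i set" and r :: "'i \<Rightarrow> 'a \<Rightarrow> real" and \<phi> :: "'i \<Rightarrow> 'a \<Rightarrow> 'a"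
  assumes L_eq: "L f \<eta> = (\<Sum>i\<in>I. r i \<eta> * (f (\<phi> i \<eta>) - f \<eta>))"
    and fin: "finite I"
    and rate: "\<lbrakk>i \<in> I; \<eta> \<in> S\<rbrakk> \<Longrightarrow> 0 \<le> r i \<eta> \<and> r i \<eta> \<le> 1"
    and closed: "\<lbrakk>i \<in> I; \<eta> \<in> S; r i \<eta> \<noteq> 0\<rbrakk> \<Longrightarrow> \<phi> i \<eta> \<in> S"
begin

definition c :: real where "c = real (card I)"

definition A :: "('a \<Rightarrow> real) \<Rightarrow> 'a \<Rightarrow> real" where "A f \<eta> = L f \<eta> + c * f \<eta>"

lemma A_eq: "A f \<eta> = (\<Sum>i\<in>I. r i \<eta> * f (\<phi> i \<eta>) + (1 - r i \<eta>) * f \<eta>)"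
  by (simp add: A_def L_eq c_def algebra_simps sum.distrib sum_subtractf)

lemma A_nonneg: "\<forall>\<eta>\<in>S. 0 \<le> f \<eta> \<Longrightarrow> \<forall>\<eta>\<in>S. 0 \<le> A f \<eta>"
  unfolding A_eq using rate closed
  by (intro ballI sum_nonneg add_nonneg_nonneg) (metis mult_eq_0_iff mult_nonneg_nonneg order_refl, simp)

lemma A_bound:
  assumes f: "\<forall>\<eta>\<in>S. \<bar>f \<eta>\<bar> \<le> B" and \<eta>: "\<eta> \<in> S"
  shows "\<bar>A f \<eta>\<bar> \<le> c * B"
proof -
  have "\<bar>r i \<eta> * f (\<phi> i \<eta>) + (1 - r i \<eta>) * f \<eta>\<bar> \<le> B" if i: "i \<in> I" for i
  proof -
    have "\<bar>r i \<eta> * f (\<phi> i \<eta>)\<bar> \<le> r i \<eta> * B"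
      using rate[OF i \<eta>] closed[OF i \<eta>] f by (cases "r i \<eta> = 0") (auto simp: abs_mult intro: mult_left_mono)
    moreover have "\<bar>(1 - r i \<eta>) * f \<eta>\<bar> \<le> (1 - r i \<eta>) * B"
      using rate[OF i \<eta>] f \<eta> by (auto simp: abs_mult intro: mult_left_mono)
    ultimately show ?thesis by (simp add: algebra_simps) 
  qed
  hence "\<bar>A f \<eta>\<bar> \<le> (\<Sum>i\<in>I. B)" unfolding A_eq by (intro order_trans[OF sum_abs] sum_mono)
  thus ?thesis by (simp add: c_def)
qed

lemma A_pow_nonneg: "\<forall>\<eta>\<in>S. 0 \<le> f \<eta> \<Longrightarrow> \<forall>\<eta>\<in>S. 0 \<le> (A ^^ n) f \<eta>"
  by (induction n) (auto dest: A_nonneg)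

lemma A_pow_bound: "\<forall>\<eta>\<in>S. \<bar>f \<eta>\<bar> \<le> B \<Longrightarrow> \<forall>\<eta>\<in>S. \<bar>(A ^^ n) f \<eta>\<bar> \<le> c ^ n * B"
  by (induction n) (auto dest: A_bound simp: mult.assoc)

lemma L_comb: "L (\<lambda>\<xi>. f \<xi> + k * g \<xi>) \<eta> = L f \<eta> + k * L g \<eta>"
  by (simp add: L_eq sum_distrib_left flip: sum.distrib) (simp add: algebra_simps)

lemma L_pow_comb: "(L ^^ n) (\<lambda>\<xi>. f \<xi> + k * g \<xi>) = (\<lambda>\<eta>. (L ^^ n) f \<eta> + k * (L ^^ n) g \<eta>)"
proof (induction n)
  case (Suc n)
  show ?case by (simp only: funpow.simps o_apply Suc) (rule ext, rule L_comb)
qed simp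

lemma L_pow_zero: "(L ^^ n) (\<lambda>_. 0) = (\<lambda>_. 0)"
proof (induction n)
  case (Suc n)
  show ?case by (simp only: funpow.simps o_apply Suc) (simp add: L_eq)
qed simp

lemma L_pow_sum: "finite T \<Longrightarrow> (L ^^ n) (\<lambda>\<xi>. \<Sum>j\<in>T. f j \<xi>) = (\<lambda>\<eta>. \<Sum>j\<in>T. (L ^^ n) (f j) \<eta>)"
proof (induction T rule: finite_induct)
  case empty
  show ?case by (simp add: L_pow_zero)
next
  case (insert j T)
  thus ?case using L_pow_comb[of n "f j" 1 "\<lambda>\<xi>. \<Sum>j\<in>T. f j \<xi>"] by simp
qed

lemma L_pow_local:
  "\<forall>\<eta>\<in>S. f \<eta> = g \<eta> \<Longrightarrow> \<forall>\<eta>\<in>S. (L ^^ n) f \<eta> = (L ^^ n) g \<eta>"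
proof (induction n)
  case (Suc n)
  hence IH: "(L ^^ n) f \<eta> = (L ^^ n) g \<eta>" if "\<eta> \<in> S" for \<eta>
    using that by blast
  show ?case
  proof
    fix \<eta> assume \<eta>: "\<eta> \<in> S"
    have "r i \<eta> * ((L ^^ n) f (\<phi> i \<eta>) - (L ^^ n) f \<eta>) = r i \<eta> * ((L ^^ n) g (\<phi> i \<eta>) - (L ^^ n) g \<eta>)"
      if "i \<in> I" for i
      using IH[OF \<eta>] IH[OF closed[OF that \<eta>]] by (cases "r i \<eta> = 0") simp_all
    thus "(L ^^ Suc n) f \<eta> = (L ^^ Suc n) g \<eta>" 
      unfolding funpow.simps o_apply L_eq by (rule sum.cong[OF refl])
  qed
qed auto

lemma L_pow_A:
  "(L ^^ n) ((A ^^ m) f) \<eta> = (\<Sum>k\<le>n. real (n choose k) * (- c) ^ (n - k) * (A ^^ (m + k)) f \<eta>)"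
proof (induction n arbitrary: m)
  case (Suc n)
  let ?a = "\<lambda>k. (A ^^ (m + k)) f \<eta>"
  have "L ((A ^^ m) f) = (\<lambda>\<xi>. (A ^^ (m + 1)) f \<xi> + (- c) * (A ^^ m) f \<xi>)"
    by (auto simp: fun_eq_iff A_def)
  hence "(L ^^ Suc n) ((A ^^ m) f) \<eta> = (L ^^ n) ((A ^^ (m + 1)) f) \<eta> + (- c) * (L ^^ n) ((A ^^ m) f) \<eta>"
    by (simp only: funpow_Suc_right o_apply L_pow_comb)
  also have "\<dots> = (\<Sum>k\<le>n. real (n choose k) * (- c) ^ (n - k) * ?a (Suc k))
      + (\<Sum>k\<le>n. real (n choose k) * (- c) ^ (Suc n - k) * ?a k)"
  proof -
    have "(- c) * (real (n choose k) * (- c) ^ (n - k) * ?a k)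
        = real (n choose k) * (- c) ^ (Suc n - k) * ?a k" if "k \<le> n" for k
      using that by (simp only: Suc_diff_le power_Suc mult_ac)
    hence "(- c) * (L ^^ n) ((A ^^ m) f) \<eta> = (\<Sum>k\<le>n. real (n choose k) * (- c) ^ (Suc n - k) * ?a k)"
      unfolding Suc[of m] sum_distrib_left by (intro sum.cong) auto
    thus ?thesis unfolding Suc[of "m + 1"] by (simp only: add_Suc_right add_Suc add_0_right One_nat_def)
  qed
  also have "(\<Sum>k\<le>n. real (n choose k) * (- c) ^ (Suc n - k) * ?a k)
      = (\<Sum>k\<le>Suc n. real (n choose k) * (- c) ^ (Suc n - k) * ?a k)" by simp
  also have "\<dots> = (- c) ^ Suc n * ?a 0 + (\<Sum>k\<le>n. real (n choose Suc k) * (- c) ^ (n - k) * ?a (Suc k))"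
    by (subst sum.atMost_Suc_shift) simp
  also have "(\<Sum>k\<le>n. real (n choose k) * (- c) ^ (n - k) * ?a (Suc k)) + \<dots>
      = (\<Sum>k\<le>Suc n. real (Suc n choose k) * (- c) ^ (Suc n - k) * ?a k)"
    by (subst sum.atMost_Suc_shift) (simp add: algebra_simps sum.distrib del: funpow.simps)
  finally show ?case .
qed auto

lemma semigroup_sums:
  assumes f: "\<forall>\<eta>\<in>S. \<bar>f \<eta>\<bar> \<le> B" and \<eta>: "\<eta> \<in> S"
  shows "(\<lambda>n. t ^ n / fact n * (L ^^ n) f \<eta>) sums
           ((\<Sum>n. t ^ n / fact n * (A ^^ n) f \<eta>) * exp (- (c * t)))"
proof -
  let ?a = "\<lambda>n. t ^ n / fact n * (A ^^ n) f \<eta>" and ?b = "\<lambda>n. (- (c * t)) ^ n / fact n"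
  have "summable (\<lambda>n. norm (?a n))"
  proof (rule summable_comparison_test')
    show "summable (\<lambda>n. inverse (fact n) * (\<bar>t\<bar> * c) ^ n * B)"
      by (intro summable_mult2 summable_exp)
    fix n :: nat
    have "\<bar>t\<bar> ^ n / fact n * \<bar>(A ^^ n) f \<eta>\<bar> \<le> \<bar>t\<bar> ^ n / fact n * (c ^ n * B)"
      using A_pow_bound[OF f, of n] \<eta> by (intro mult_left_mono) auto
    thus "norm (norm (?a n)) \<le> inverse (fact n) * (\<bar>t\<bar> * c) ^ n * B"
      by (simp add: abs_mult power_abs field_simps)
  qed
  moreover have "summable (\<lambda>n. norm (?b n))"
    using summable_norm_exp[of "- (c * t)"] by (simp add: field_simps)
  ultimately have "(\<lambda>n. \<Sum>k\<le>n. ?a k * ?b (n - k)) sums ((\<Sum>n. ?a n) * (\<Sum>n. ?b n))"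
    by (rule Cauchy_product_sums)
  moreover have "(\<Sum>n. ?b n) = exp (- (c * t))" by (simp add: exp_def field_simps)
  moreover have "(\<Sum>k\<le>n. ?a k * ?b (n - k)) = t ^ n / fact n * (L ^^ n) f \<eta>" for n
  proof -
    have "?a k * ?b (n - k)
        = t ^ n / fact n * (real (n choose k) * (- c) ^ (n - k) * (A ^^ k) f \<eta>)" if k: "k \<le> n" for k
    proof -
      have "t ^ n = t ^ k * t ^ (n - k)" using k by (simp flip: power_add)
      moreover have "(- (c * t)) ^ (n - k) = (- c) ^ (n - k) * t ^ (n - k)"
        by (simp flip: power_mult_distrib)
      ultimately show ?thesis using k by (simp add: binomial_fact)
    qed
    thus ?thesis using L_pow_A[of n 0 f \<eta>] by (simp add: sum_distrib_left)
  qed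
  ultimately show ?thesis by simp
qed

lemma semigroup_nonneg:
  assumes "\<forall>\<eta>\<in>S. 0 \<le> f \<eta> \<and> f \<eta> \<le> B" and "\<eta> \<in> S" and "0 \<le> t"
  shows "0 \<le> semigroup L t f \<eta>"
proof -
  have s: "\<forall>\<eta>\<in>S. \<bar>f \<eta>\<bar> \<le> B" using assms by auto
  have "summable (\<lambda>n. t ^ n / fact n * (A ^^ n) f \<eta>)"
  proof (rule summable_comparison_test')
    show "summable (\<lambda>n. inverse (fact n) * (\<bar>t\<bar> * c) ^ n * B)"
      by (intro summable_mult2 summable_exp)
    fix n :: nat
    have "\<bar>t\<bar> ^ n / fact n * \<bar>(A ^^ n) f \<eta>\<bar> \<le> \<bar>t\<bar> ^ n / fact n * (c ^ n * B)"
      using A_pow_bound[OF s, of n] assms by (intro mult_left_mono) auto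
    thus "norm (t ^ n / fact n * (A ^^ n) f \<eta>) \<le> inverse (fact n) * (\<bar>t\<bar> * c) ^ n * B"
      by (simp add: abs_mult power_abs field_simps)
  qed
  hence "0 \<le> (\<Sum>n. t ^ n / fact n * (A ^^ n) f \<eta>)"
    using A_pow_nonneg[of f] assms by (intro suminf_nonneg) auto
  thus ?thesis
    unfolding semigroup_def sums_unique[OF semigroup_sums[OF s assms(2)], symmetric] by simp
qed

lemma semigroup_outside:
  assumes "\<forall>\<eta>\<in>S. f \<eta> = 0" and "\<eta> \<in> S"
  shows "semigroup L t f \<eta> = 0"
proof -
  have "(L ^^ n) f \<eta> = 0" for n
    using L_pow_local[of f "\<lambda>_. 0" n] assms by (auto simp: L_pow_zero)
  thus ?thesis by (simp add: semigroup_def)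
qed

lemma sum_semigroup:
  assumes "finite S" and "\<eta> \<in> S"
  shows "(\<Sum>\<xi>\<in>S. semigroup L t (indicator {\<xi>}) \<eta>) = 1"
proof -
  have "(\<Sum>\<xi>\<in>S. semigroup L t (indicator {\<xi>}) \<eta>) =
        (\<Sum>n. t ^ n / fact n * (L ^^ n) (\<lambda>\<zeta>. \<Sum>\<xi>\<in>S. indicator {\<xi>} \<zeta>) \<eta>)"
  proof -
    have "summable (\<lambda>n. t ^ n / fact n * (L ^^ n) (indicator {\<xi>}) \<eta>)" for \<xi>
      by (rule sums_summable, rule semigroup_sums[where B = 1]) (auto simp: indicator_def assms)
    thus ?thesis
      unfolding semigroup_def L_pow_sum[OF assms(1)] sum_distrib_left by (rule suminf_sum[symmetric])
  qed
  also have "\<dots> = (\<Sum>n. t ^ n / fact n * (L ^^ n) (\<lambda>_. 1) \<eta>)"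
  proof -
    have "(L ^^ n) (\<lambda>\<zeta>. \<Sum>\<xi>\<in>S. indicator {\<xi>} \<zeta>) \<eta> = (L ^^ n) (\<lambda>_. 1) \<eta>" for n
      using L_pow_local[of "\<lambda>\<zeta>. \<Sum>\<xi>\<in>S. indicator {\<xi>} \<zeta>" "\<lambda>_. 1" n] assms
      by (auto simp: indicator_def)
    thus ?thesis by simp
  qed
  also have "\<dots> = (\<Sum>n. if n = 0 then 1 else 0)"
  proof (intro suminf_cong)
    fix n :: nat
    have "L (\<lambda>_. 1) = (\<lambda>_. 0)" by (auto simp: L_eq)
    thus "t ^ n / fact n * (L ^^ n) (\<lambda>_. 1) \<eta> = (if n = 0 then 1 else 0)"
      by (cases n) (simp_all add: funpow_Suc_right L_pow_zero del: funpow.simps(2))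
  qed
  also have "\<dots> = 1" using suminf_finite[of "{0 :: nat}" "\<lambda>n. if n = 0 then 1 else 0 :: real"] by simp
  finally show ?thesis .
qed

end

lemma fep_jump_generator:
  "jump_generator (fep_generator N) (configs N K) (torus N \<times> {1, -1})
     (\<lambda>(x, z) \<eta>. real (\<eta> x) * real (\<eta> ((x - z) mod int N)) * (1 - real (\<eta> ((x + z) mod int N))))
     (\<lambda>(x, z) \<eta>. exchange \<eta> x ((x + z) mod int N))"
proof
  show "finite (torus N \<times> {1, -1 :: int})" by (auto simp: torus_def)
next
  fix f \<eta>
  show "fep_generator N f \<eta> = (\<Sum>i\<in>torus N \<times> {1, -1}.
     (case i of (x, z) \<Rightarrow> \<lambda>\<eta>. real (\<eta> x) * real (\<eta> ((x - z) mod int N)) * (1 - real (\<eta> ((x + z) mod int N)))) \<eta>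
     * (f ((case i of (x, z) \<Rightarrow> \<lambda>\<eta>. exchange \<eta> x ((x + z) mod int N)) \<eta>) - f \<eta>))"
    unfolding fep_generator_def by (subst sum.cartesian_product) (auto intro!: sum.cong)
next
  fix i :: "int \<times> int" and \<eta>
  assume i: "i \<in> torus N \<times> {1, -1}" and \<eta>: "\<eta> \<in> configs N K"
  obtain x z where iz: "i = (x, z)" by (cases i)
  let ?y = "(x + z) mod int N"
  have x: "x \<in> torus N" and y: "?y \<in> torus N" and w: "(x - z) mod int N \<in> torus N"
    using i iz by (auto simp: torus_def)
  have v: "\<eta> u = 0 \<or> \<eta> u = 1" if "u \<in> torus N" for u
    using \<eta> that by (auto simp: configs_def)
  show "0 \<le> (case i of (x, z) \<Rightarrow> \<lambda>\<eta>. real (\<eta> x) * real (\<eta> ((x - z) mod int N)) * (1 - real (\<eta> ((x + z) mod int N)))) \<eta>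
    \<and> (case i of (x, z) \<Rightarrow> \<lambda>\<eta>. real (\<eta> x) * real (\<eta> ((x - z) mod int N)) * (1 - real (\<eta> ((x + z) mod int N)))) \<eta> \<le> 1"
    using v[OF x] v[OF y] v[OF w] iz by auto
  have eq: "exchange \<eta> x ?y = \<eta> \<circ> Transposition.transpose x ?y"
    by (auto simp: exchange_def fun_eq_iff transpose_def)
  have "(\<Sum>u\<in>torus N. (\<eta> \<circ> Transposition.transpose x ?y) u) = (\<Sum>u\<in>torus N. \<eta> u)"
    using x y unfolding o_def
    by (intro sum.reindex_bij_betw) (auto intro!: permutes_imp_bij permutes_swap_id)
  moreover have "exchange \<eta> x ?y \<in> torus N \<rightarrow>\<^sub>E {0, 1}"
  proof (rule PiE_I)
    fix u assume "u \<in> torus N"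
    thus "exchange \<eta> x ?y u \<in> {0, 1}" using v[of u] v[OF x] v[OF y] by (auto simp: exchange_def)
  next
    fix u assume "u \<notin> torus N"
    thus "exchange \<eta> x ?y u = undefined"
      using x y PiE_arb[of \<eta> "torus N" "\<lambda>_. {0, 1}" u] \<eta> by (auto simp: exchange_def configs_def)
  qed
  moreover have "(\<Sum>u\<in>torus N. \<eta> u) = K" using \<eta> by (simp add: configs_def)
  ultimately have "exchange \<eta> x ?y \<in> configs N K" unfolding configs_def eq by auto
  thus "(case i of (x, z) \<Rightarrow> \<lambda>\<eta>. exchange \<eta> x ((x + z) mod int N)) \<eta> \<in> configs N K"
    using iz by simp
qed

lemma pmf_fep_law:
  assumes "\<eta> \<in> configs N K" and "0 \<le> t"
  shows "pmf (fep_law N \<eta> t) \<xi> = semigroup (fep_generator N) t (indicator {\<xi>}) \<eta>"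
  unfolding fep_law_def
proof (rule pmf_embed_pmf)
  interpret jump_generator "fep_generator N" "configs N K" "torus N \<times> {1, -1}"
     "\<lambda>(x, z) \<eta>. real (\<eta> x) * real (\<eta> ((x - z) mod int N)) * (1 - real (\<eta> ((x + z) mod int N)))"
     "\<lambda>(x, z) \<eta>. exchange \<eta> x ((x + z) mod int N)"
    by (rule fep_jump_generator)
  let ?p = "\<lambda>\<xi>. semigroup (fep_generator N) t (indicator {\<xi>}) \<eta>"
  show nonneg: "0 \<le> ?p \<xi>" for \<xi>
    using assms by (intro semigroup_nonneg[where B = 1]) (auto simp: indicator_def)
  have outside: "?p \<xi> = 0" if "\<xi> \<notin> configs N K" for \<xi>
    using that assms by (intro semigroup_outside) (auto simp: indicator_def)
  have "(\<integral>\<^sup>+ \<xi>. ennreal (?p \<xi>) \<partial>count_space UNIV) = (\<Sum>\<xi>\<in>configs N K. ennreal (?p \<xi>))"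
    using outside by (intro nn_integral_count_space' finite_configs) auto
  also have "\<dots> = ennreal (\<Sum>\<xi>\<in>configs N K. ?p \<xi>)" using nonneg by (intro sum_ennreal) auto
  also have "\<dots> = 1" using sum_semigroup[OF finite_configs assms(1)] by simp
  finally show "(\<integral>\<^sup>+ \<xi>. ennreal (?p \<xi>) \<partial>count_space UNIV) = 1" .
qed

end

theory Submission
  imports Defs
begin

text \<open>
  Label each hole by the number of particles preceding it on the torus. On the ergodic component
  the holes then perform a symmetric exclusion process with \<open>N - K\<close> particles on \<open>\<int> / K\<int>\<close>, and the
  Fourier coefficient \<open>F = (\<Sum>holes. \<omega> ^ label)\<close> with \<open>\<omega> = cis (2 * pi / K)\<close> is an eigenfunction with
  eigenvalue \<open>- \<bar>1 - \<omega>\<bar>\<^sup>2\<close>, about \<open>- 4 * pi\<^sup>2 / K\<^sup>2\<close>. The labels are determined by the configuration only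
  up to a rotation, so \<open>F\<close> lives on a lift of the process, but \<open>\<bar>F\<bar>\<close> is a function of the configuration.
  As at most \<open>2 * P\<close> jumps are possible, the variance of \<open>F\<close> never exceeds \<open>P\<close>, in equilibrium
  as well as at time \<open>t\<close>. Started from a block of holes, \<open>\<bar>F\<bar>\<close> is of order \<open>P\<close>, hence its mean
  dominates the fluctuations of order \<open>sqrt P\<close> up to time \<open>ln P / (2 * \<bar>1 - \<omega>\<bar>\<^sup>2)\<close> (Wilson's method).
\<close>

section \<open>Approximate eigenfunctions of jump processes\<close>

context jump_generator begin

text \<open>The lift used below has infinitely many states, so boundedness on \<open>S\<close> is
  not automatic; it is what makes the exponential series of the semigroup converge.\<close>

definition bounded_obs :: "('a \<Rightarrow> real) \<Rightarrow> bool" where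
  "bounded_obs f \<longleftrightarrow> (\<exists>B. \<forall>\<eta>\<in>S. \<bar>f \<eta>\<bar> \<le> B)"

lemma bounded_obs_comb:
  assumes "bounded_obs f" "bounded_obs g"
  shows "bounded_obs (\<lambda>\<eta>. f \<eta> + k * g \<eta>)"
proof -
  obtain B C where B: "\<forall>\<eta>\<in>S. \<bar>f \<eta>\<bar> \<le> B" and C: "\<forall>\<eta>\<in>S. \<bar>g \<eta>\<bar> \<le> C"
    using assms by (auto simp: bounded_obs_def)
  have "\<bar>f \<eta> + k * g \<eta>\<bar> \<le> B + \<bar>k\<bar> * C" if "\<eta> \<in> S" for \<eta>
  proof -
    have "\<bar>k * g \<eta>\<bar> \<le> \<bar>k\<bar> * C"
      using C that by (auto simp: abs_mult intro: mult_left_mono)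
    moreover have "\<bar>f \<eta>\<bar> \<le> B" using B that by blast
    ultimately show ?thesis using abs_triangle_ineq[of "f \<eta>" "k * g \<eta>"] by linarith
  qed
  thus ?thesis unfolding bounded_obs_def by blast
qed

lemma bounded_obs_const: "bounded_obs (\<lambda>_. k)"
  by (auto simp: bounded_obs_def)

lemma bounded_obs_power2:
  assumes "bounded_obs f"
  shows "bounded_obs (\<lambda>\<eta>. (f \<eta>)\<^sup>2)"
proof -
  obtain B where B: "\<forall>\<eta>\<in>S. \<bar>f \<eta>\<bar> \<le> B" using assms by (auto simp: bounded_obs_def)
  have "\<bar>(f \<eta>)\<^sup>2\<bar> \<le> B\<^sup>2" if "\<eta> \<in> S" for \<eta>
    using power_mono[of "\<bar>f \<eta>\<bar>" B 2] B that by auto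
  thus ?thesis unfolding bounded_obs_def by blast
qed

lemma summable_semigroup:
  assumes "bounded_obs f" "\<eta> \<in> S"
  shows "summable (\<lambda>n. t ^ n / fact n * (L ^^ n) f \<eta>)"
  using assms semigroup_sums unfolding bounded_obs_def by (blast intro: sums_summable)

lemma semigroup_comb:
  assumes "bounded_obs f" "bounded_obs g" "\<eta> \<in> S"
  shows "semigroup L t (\<lambda>\<xi>. f \<xi> + k * g \<xi>) \<eta> = semigroup L t f \<eta> + k * semigroup L t g \<eta>"
proof -
  have "semigroup L t (\<lambda>\<xi>. f \<xi> + k * g \<xi>) \<eta> =
      (\<Sum>n. t ^ n / fact n * (L ^^ n) f \<eta> + k * (t ^ n / fact n * (L ^^ n) g \<eta>))"
    unfolding semigroup_def L_pow_comb by (simp add: algebra_simps)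
  also have "\<dots> = semigroup L t f \<eta> + k * semigroup L t g \<eta>"
    unfolding semigroup_def
    by (subst suminf_add[symmetric])
       (auto intro!: summable_mult summable_semigroup assms simp: suminf_mult[OF summable_semigroup] assms
         simp del: times_divide_eq_left)
  finally show ?thesis .
qed

lemma semigroup_cong:
  assumes "\<forall>\<eta>\<in>S. f \<eta> = g \<eta>" "\<eta> \<in> S"
  shows "semigroup L t f \<eta> = semigroup L t g \<eta>"
  unfolding semigroup_def using L_pow_local[OF assms(1)] assms(2) by simp

lemma semigroup_mono:
  assumes "bounded_obs f" "bounded_obs g" "\<forall>\<eta>\<in>S. f \<eta> \<le> g \<eta>" "\<eta> \<in> S" "0 \<le> t"
  shows "semigroup L t f \<eta> \<le> semigroup L t g \<eta>"
proof -
  obtain B where B: "\<forall>\<eta>\<in>S. \<bar>g \<eta> + (- 1) * f \<eta>\<bar> \<le> B"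
    using bounded_obs_comb[OF assms(2,1), of "- 1"] by (auto simp: bounded_obs_def)
  have "0 \<le> semigroup L t (\<lambda>\<eta>. g \<eta> + (- 1) * f \<eta>) \<eta>"
    using B assms by (intro semigroup_nonneg[where B = B]) auto
  thus ?thesis unfolding semigroup_comb[OF assms(2,1,4)] by simp
qed

lemma semigroup_indicator:
  assumes "finite T" "\<eta> \<in> S"
  shows "semigroup L t (indicator T) \<eta> = (\<Sum>\<xi>\<in>T. semigroup L t (indicator {\<xi>}) \<eta>)"
  using assms(1)
proof (induction T rule: finite_induct)
  case empty
  show ?case using assms(2) by (intro semigroup_outside[THEN trans]) auto
next
  case (insert \<xi> T)
  have "semigroup L t (indicator (insert \<xi> T)) \<eta> =
        semigroup L t (\<lambda>\<zeta>. indicator T \<zeta> + 1 * indicator {\<xi>} \<zeta>) \<eta>"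
    using insert.hyps(2) assms(2) by (intro semigroup_cong) (auto simp: indicator_def)
  also have "\<dots> = semigroup L t (indicator T) \<eta> + 1 * semigroup L t (indicator {\<xi>}) \<eta>"
    using assms(2) by (intro semigroup_comb) (auto simp: bounded_obs_def indicator_def intro: exI[of _ 1])
  finally show ?case using insert by simp
qed

section \<open>Decay of eigenfunctions and tail bounds\<close>

lemma A_mono:
  assumes "\<forall>\<eta>\<in>S. f \<eta> \<le> g \<eta>" "\<eta> \<in> S"
  shows "A f \<eta> \<le> A g \<eta>"
proof -
  have "r i \<eta> * f (\<phi> i \<eta>) \<le> r i \<eta> * g (\<phi> i \<eta>)" if "i \<in> I" for i
    using rate[OF that assms(2)] closed[OF that assms(2)] assms(1)
    by (cases "r i \<eta> = 0") (auto intro: mult_left_mono)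
  thus ?thesis
    unfolding A_eq using rate[OF _ assms(2)] assms
    by (intro sum_mono add_mono) (auto intro: mult_left_mono)
qed

text \<open>\<open>A = L + c\<close> preserves order, since the rates are at most 1 and
  \<open>c\<close> counts the possible jumps. The hypothesis therefore iterates to a bound on
  \<open>(A ^^ n) g\<close>, where \<open>\<mu> \<le> c\<close> keeps the factors
  \<open>c - \<mu>\<close> nonnegative. Summing the exponential series and multiplying by
  \<open>exp (- (c * t))\<close> replaces a Gronwall argument in \<open>t\<close>.\<close>

lemma semigroup_decay:
  assumes g: "bounded_obs g" and Lg: "\<forall>\<eta>\<in>S. L g \<eta> \<le> - \<mu> * g \<eta>"
    and "\<mu> \<le> c" "\<eta> \<in> S" "0 \<le> t"
  shows "semigroup L t g \<eta> \<le> exp (- \<mu> * t) * g \<eta>"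
proof -
  have A_pow_le: "\<forall>\<eta>\<in>S. (A ^^ n) g \<eta> \<le> (c - \<mu>) ^ n * g \<eta>" for n
  proof (induction n)
    case (Suc n)
    show ?case
    proof
      fix \<eta> assume \<eta>: "\<eta> \<in> S"
      have "(A ^^ Suc n) g \<eta> \<le> A (\<lambda>\<xi>. (c - \<mu>) ^ n * g \<xi>) \<eta>"
        using A_mono[OF Suc \<eta>] by simp
      also have "\<dots> = (c - \<mu>) ^ n * A g \<eta>"
        by (simp add: A_eq sum_distrib_left algebra_simps)
      also have "\<dots> \<le> (c - \<mu>) ^ n * ((c - \<mu>) * g \<eta>)"
        using Lg \<eta> assms(3) by (intro mult_left_mono) (auto simp: A_def algebra_simps)
      finally show "(A ^^ Suc n) g \<eta> \<le> (c - \<mu>) ^ Suc n * g \<eta>" by (simp add: mult_ac)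
    qed
  qed simp
  obtain B where B: "\<forall>\<eta>\<in>S. \<bar>g \<eta>\<bar> \<le> B" using g by (auto simp: bounded_obs_def)
  have exp_sums: "(\<lambda>n. t ^ n / fact n * ((c - \<mu>) ^ n * g \<eta>)) sums (exp ((c - \<mu>) * t) * g \<eta>)"
    using sums_mult2[OF exp_converges[of "(c - \<mu>) * t"], of "g \<eta>"]
    by (simp add: power_mult_distrib mult_ac divide_inverse)
  have "summable (\<lambda>n. t ^ n / fact n * (A ^^ n) g \<eta>)"
  proof (rule summable_comparison_test')
    show "summable (\<lambda>n. inverse (fact n) * (\<bar>t\<bar> * c) ^ n * B)"
      by (intro summable_mult2 summable_exp)
    fix n :: nat
    have "\<bar>t\<bar> ^ n / fact n * \<bar>(A ^^ n) g \<eta>\<bar> \<le> \<bar>t\<bar> ^ n / fact n * (c ^ n * B)"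
      using A_pow_bound[OF B, of n] assms by (intro mult_left_mono) auto
    thus "norm (t ^ n / fact n * (A ^^ n) g \<eta>) \<le> inverse (fact n) * (\<bar>t\<bar> * c) ^ n * B"
      by (simp add: abs_mult power_abs field_simps)
  qed
  moreover have "t ^ n / fact n * (A ^^ n) g \<eta> \<le> t ^ n / fact n * ((c - \<mu>) ^ n * g \<eta>)" for n
    using A_pow_le[of n] assms(4,5) by (intro mult_left_mono) auto
  ultimately have "(\<Sum>n. t ^ n / fact n * (A ^^ n) g \<eta>) \<le> exp ((c - \<mu>) * t) * g \<eta>"
    unfolding sums_unique[OF exp_sums] by (intro suminf_le sums_summable[OF exp_sums])
  hence "semigroup L t g \<eta> \<le> exp ((c - \<mu>) * t) * g \<eta> * exp (- (c * t))"
    unfolding semigroup_def sums_unique[OF semigroup_sums[OF B assms(4)], symmetric]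
    by (intro mult_right_mono) auto
  also have "\<dots> = exp (- \<mu> * t) * g \<eta>"
    by (simp add: algebra_simps flip: exp_add)
  finally show ?thesis .
qed

lemma semigroup_eigen:
  assumes g: "bounded_obs g" and Lg: "\<forall>\<eta>\<in>S. L g \<eta> = - \<mu> * g \<eta>"
    and "\<mu> \<le> c" "\<eta> \<in> S" "0 \<le> t"
  shows "semigroup L t g \<eta> = exp (- \<mu> * t) * g \<eta>"
proof (rule antisym)
  show "semigroup L t g \<eta> \<le> exp (- \<mu> * t) * g \<eta>"
    using assms by (intro semigroup_decay) auto
  \<comment> \<open>The lower bound is the decay estimate for \<open>- g\<close>, written in the
    form that \<open>semigroup_comb\<close> accepts.\<close>
  let ?g = "\<lambda>\<xi>. 0 + (- 1) * g \<xi>"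
  have "L ?g \<xi> = - L g \<xi>" for \<xi>
    using L_comb[of "\<lambda>_. 0" "- 1" g \<xi>] L_pow_zero[of 1] by simp
  hence "semigroup L t ?g \<eta> \<le> exp (- \<mu> * t) * ?g \<eta>"
    using assms by (intro semigroup_decay bounded_obs_comb bounded_obs_const) auto
  moreover have "semigroup L t (\<lambda>_. 0) \<eta> = 0"
    using assms(4) by (intro semigroup_outside) auto
  ultimately show "exp (- \<mu> * t) * g \<eta> \<le> semigroup L t g \<eta>"
    using semigroup_comb[OF bounded_obs_const[of 0] g assms(4), of t "- 1"] by simp
qed

lemma semigroup_const:
  assumes "\<eta> \<in> S" "0 \<le> t"
  shows "semigroup L t (\<lambda>_. k) \<eta> = k"
  using semigroup_eigen[OF bounded_obs_const[of k], of 0] assms by (simp add: L_eq c_def)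

text \<open>Subtracting \<open>V\<close> absorbs the source term:
  \<open>(R \<eta>)\<^sup>2 - V\<close> decays at rate \<open>2 * \<mu>\<close>, exactly the rate of
  the squared mean. Hence the second moment at time \<open>t\<close> exceeds the squared mean by at
  most \<open>V\<close>.\<close>

lemma eigenfunction_variance:
  assumes R: "bounded_obs R"
    and LR: "\<forall>\<eta>\<in>S. L R \<eta> = - \<mu> * R \<eta>"
    and LR2: "\<forall>\<eta>\<in>S. L (\<lambda>\<eta>. (R \<eta>)\<^sup>2) \<eta> \<le> - (2 * \<mu>) * (R \<eta>)\<^sup>2 + 2 * \<mu> * V"
    and "0 \<le> \<mu>" "2 * \<mu> \<le> c" "0 \<le> V" "\<eta> \<in> S" "0 \<le> t"
  shows "semigroup L t (\<lambda>\<xi>. (R \<xi> - exp (- \<mu> * t) * R \<eta>)\<^sup>2) \<eta> \<le> V"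
proof -
  define m where "m = exp (- \<mu> * t) * R \<eta>"
  let ?g = "\<lambda>\<xi>. (R \<xi>)\<^sup>2 + V * (- 1)"
  have g: "bounded_obs ?g" by (intro bounded_obs_comb bounded_obs_power2 R bounded_obs_const)
  have "L ?g \<xi> = L (\<lambda>\<eta>. (R \<eta>)\<^sup>2) \<xi>" for \<xi>
    by (simp add: L_eq)
  hence "semigroup L t ?g \<eta> \<le> exp (- (2 * \<mu>) * t) * ?g \<eta>"
    using assms by (intro semigroup_decay g) (auto simp: algebra_simps)
  also have "\<dots> = m\<^sup>2 - exp (- (2 * \<mu>) * t) * V"
    by (simp add: m_def power_mult_distrib algebra_simps power2_eq_square flip: exp_add mult_2)
  also have "\<dots> \<le> m\<^sup>2" using assms by simp
  finally have sg: "semigroup L t ?g \<eta> \<le> m\<^sup>2" .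
  have sR: "semigroup L t R \<eta> = m"
    unfolding m_def using assms by (intro semigroup_eigen) auto
  have "semigroup L t (\<lambda>\<xi>. (R \<xi> - m)\<^sup>2) \<eta> =
        semigroup L t (\<lambda>\<xi>. (?g \<xi> + (- 2 * m) * R \<xi>) + (m\<^sup>2 + V) * 1) \<eta>"
    using assms(7) by (intro semigroup_cong) (auto simp: power2_eq_square algebra_simps)
  also have "\<dots> = semigroup L t ?g \<eta> + (- 2 * m) * semigroup L t R \<eta> + (m\<^sup>2 + V) * 1"
    using assms(7,8) g R
    by (simp only: semigroup_comb bounded_obs_comb bounded_obs_const semigroup_const)
  also have "\<dots> \<le> m\<^sup>2 - 2 * m * m + m\<^sup>2 + V" using sg sR by simp
  also have "\<dots> = V" by (simp add: power2_eq_square)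
  finally show ?thesis by (simp add: m_def)
qed

text \<open>Chebyshev's inequality: on \<open>T\<close> the observable lies at least
  \<open>exp (- \<mu> * t) * R \<eta> - a\<close> below its mean, and its variance is at most
  \<open>V\<close>.\<close>

lemma eigenfunction_tail:
  assumes R: "bounded_obs R"
    and LR: "\<forall>\<eta>\<in>S. L R \<eta> = - \<mu> * R \<eta>"
    and LR2: "\<forall>\<eta>\<in>S. L (\<lambda>\<eta>. (R \<eta>)\<^sup>2) \<eta> \<le> - (2 * \<mu>) * (R \<eta>)\<^sup>2 + 2 * \<mu> * V"
    and "0 \<le> \<mu>" "2 * \<mu> \<le> c" "0 \<le> V" "\<eta> \<in> S" "0 \<le> t"
    and "a < exp (- \<mu> * t) * R \<eta>"
    and T: "\<And>\<xi>. \<lbrakk>\<xi> \<in> S; \<xi> \<in> T\<rbrakk> \<Longrightarrow> R \<xi> \<le> a"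
  shows "semigroup L t (indicator T) \<eta> \<le> V / (exp (- \<mu> * t) * R \<eta> - a)\<^sup>2"
proof -
  define m where "m = exp (- \<mu> * t) * R \<eta>"
  let ?d = "(m - a)\<^sup>2" and ?f = "\<lambda>\<xi>. (R \<xi> - m)\<^sup>2"
  have am: "a < m" using assms by (simp add: m_def)
  have "bounded_obs (\<lambda>\<xi>. R \<xi> + (- m) * 1)" by (intro bounded_obs_comb R bounded_obs_const)
  hence f: "bounded_obs ?f" using bounded_obs_power2 by force
  have ind: "bounded_obs (indicator T)" by (auto simp: bounded_obs_def indicator_def intro: exI[of _ 1])
  have "indicator T \<xi> \<le> 0 + 1 / ?d * ?f \<xi>" if "\<xi> \<in> S" for \<xi>
  proof (cases "\<xi> \<in> T")
    case True
    hence "m - a \<le> m - R \<xi>" using T that by simp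
    hence "?d \<le> (m - R \<xi>)\<^sup>2" using am by (intro power_mono) auto
    thus ?thesis using am True by (simp add: power2_commute)
  qed simp
  hence "semigroup L t (indicator T) \<eta> \<le> semigroup L t (\<lambda>\<xi>. 0 + 1 / ?d * ?f \<xi>) \<eta>"
    using assms(7,8) by (intro semigroup_mono ind bounded_obs_comb bounded_obs_const f) auto
  also have "\<dots> = 0 + 1 / ?d * semigroup L t ?f \<eta>"
    using assms(7,8) by (simp only: semigroup_comb bounded_obs_const f semigroup_const)
  also have "\<dots> \<le> V / ?d"
    using eigenfunction_variance[OF assms(1-8)] by (simp add: m_def divide_right_mono)
  finally show ?thesis by (simp add: m_def)
qed

end

section \<open>Trigonometric and total variation estimates\<close>

lemma norm_one_minus_cis: "norm (1 - cis x) = 2 * \<bar>sin (x / 2)\<bar>"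
proof -
  have "(norm (1 - cis x))\<^sup>2 = 2 * (1 - cos x)"
    unfolding cmod_power2 using sin_cos_squared_add[of x]
    by (simp add: power2_eq_square algebra_simps)
  also have "cos x = 1 - 2 * (sin (x / 2))\<^sup>2" using cos_double_sin[of "x / 2"] by simp
  also have "2 * (1 - (1 - 2 * (sin (x / 2))\<^sup>2)) = (2 * \<bar>sin (x / 2)\<bar>)\<^sup>2"
    by (simp add: power_mult_distrib)
  finally show ?thesis by (rule power2_eq_imp_eq) auto
qed

text \<open>Jordan's inequality: a concave function lies above its chord.\<close>

lemma sin_ge_chord:
  assumes "0 \<le> x" "x \<le> pi / 2"
  shows "2 * x / pi \<le> sin x"
proof -
  have "concave_on {0..pi / 2} sin"
  proof (rule f''_le0_imp_concave)
    show "- sin x \<le> 0" if "x \<in> {0..pi / 2}" for x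
      using that by (auto intro: sin_ge_zero)
  qed (auto intro!: derivative_eq_intros)
  hence "sin ((1 - 2 * x / pi) *\<^sub>R 0 + (2 * x / pi) *\<^sub>R (pi / 2)) \<ge> (1 - 2 * x / pi) * sin 0 + 2 * x / pi * sin (pi / 2)"
    using assms by (intro concave_onD) (auto simp: field_simps)
  thus ?thesis by simp
qed

lemma tv_dist_ge: "measure_pmf.prob q T - measure_pmf.prob p T \<le> tv_dist p q"
proof -
  have "\<bar>measure_pmf.prob p T - measure_pmf.prob q T\<bar> \<le> tv_dist p q"
    unfolding tv_dist_def
  proof (rule cSUP_upper)
    have "\<bar>measure_pmf.prob p A - measure_pmf.prob q A\<bar> \<le> 1" for A
      using measure_pmf.prob_le_1[of p A] measure_pmf.prob_le_1[of q A]
        measure_nonneg[of "measure_pmf p" A] measure_nonneg[of "measure_pmf q" A] by linarith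
    thus "bdd_above (range (\<lambda>A. \<bar>measure_pmf.prob p A - measure_pmf.prob q A\<bar>))"
      by (auto simp: bdd_above_def)
  qed simp
  thus ?thesis by linarith
qed

section \<open>The lift of the ergodic component\<close>

locale fep_component =
  fixes N K :: nat
  assumes size: "3 \<le> N" "N < 2 * K" "K < N"
begin

section \<open>Cyclic neighbours and ergodic configurations\<close>

definition nxt :: "int \<Rightarrow> int" where "nxt x = (x + 1) mod int N"
definition prv :: "int \<Rightarrow> int" where "prv x = (x - 1) mod int N"

lemma nxt_eq: "x \<in> torus N \<Longrightarrow> nxt x = (if x = int N - 1 then 0 else x + 1)"
  by (auto simp: nxt_def torus_def)

lemma prv_eq: "x \<in> torus N \<Longrightarrow> prv x = (if x = 0 then int N - 1 else x - 1)"
  using mod_pos_pos_trivial[of "x - 1" "int N"] size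
  by (auto simp: prv_def torus_def zmod_minus1)

text \<open>\<open>3 \<le> N\<close> makes \<open>prv x\<close>, \<open>x\<close> and
  \<open>nxt x\<close> distinct, so that the pointwise updates made by a jump do not interfere.
  Disequalities appear in both orientations for the simplifier.\<close>

lemma nxt_prv_simps [simp]:
  assumes "x \<in> torus N"
  shows "nxt x \<in> torus N" "prv x \<in> torus N" "nxt (prv x) = x" "prv (nxt x) = x"
    "nxt x \<noteq> x" "prv x \<noteq> x" "nxt x \<noteq> prv x" "x \<noteq> nxt x" "x \<noteq> prv x" "prv x \<noteq> nxt x"
proof -
  show in_torus: "nxt x \<in> torus N" "prv x \<in> torus N"
    using size by (auto simp: nxt_def prv_def torus_def)
  show "nxt (prv x) = x" "prv (nxt x) = x" "nxt x \<noteq> x" "prv x \<noteq> x" "nxt x \<noteq> prv x"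
    "x \<noteq> nxt x" "x \<noteq> prv x" "prv x \<noteq> nxt x"
    using nxt_eq[OF assms] prv_eq[OF assms] nxt_eq[OF in_torus(2)] prv_eq[OF in_torus(1)] assms size
    by (auto simp: torus_def split: if_splits)
qed

lemma nxt_inj: "x \<in> torus N \<Longrightarrow> y \<in> torus N \<Longrightarrow> nxt x = nxt y \<longleftrightarrow> x = y"
  by (metis nxt_prv_simps(4))

lemma nxt_eq_iff: "x \<in> torus N \<Longrightarrow> y \<in> torus N \<Longrightarrow> nxt x = y \<longleftrightarrow> x = prv y"
  by (metis nxt_prv_simps(3,4))

lemma sum_nxt: "(\<Sum>x\<in>torus N. f (nxt x)) = (\<Sum>x\<in>torus N. f x)"
  by (rule sum.reindex_bij_witness[of _ prv nxt]) auto

lemma sum_prv: "(\<Sum>x\<in>torus N. f (prv x)) = (\<Sum>x\<in>torus N. f x)"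
  by (rule sum.reindex_bij_witness[of _ nxt prv]) auto

lemma finite_torus [simp]: "finite (torus N)"
  by (simp add: torus_def)

lemma card_torus [simp]: "card (torus N) = N"
  by (simp add: torus_def)

lemma ergodicD:
  assumes "\<eta> \<in> ergodic N K"
  shows "\<eta> \<in> configs N K" "(\<Sum>x\<in>torus N. \<eta> x) = K"
    and "x \<in> torus N \<Longrightarrow> \<eta> x = 0 \<or> \<eta> x = 1"
    and "x \<in> torus N \<Longrightarrow> \<eta> x = 0 \<Longrightarrow> \<eta> (nxt x) = 1"
    and "x \<in> torus N \<Longrightarrow> \<eta> x = 0 \<Longrightarrow> \<eta> (prv x) = 1"
proof -
  show conf: "\<eta> \<in> configs N K" and "(\<Sum>x\<in>torus N. \<eta> x) = K"
    using assms by (auto simp: ergodic_def configs_def)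
  show v: "\<eta> x = 0 \<or> \<eta> x = 1" if "x \<in> torus N" for x
    using that conf by (auto simp: configs_def)
  have e: "\<eta> x + \<eta> (nxt x) \<ge> 1" if "x \<in> torus N" for x
    using assms that by (auto simp: ergodic_def nxt_def)
  show "\<eta> (nxt x) = 1" if "x \<in> torus N" "\<eta> x = 0"
    using e[OF that(1)] v[of "nxt x"] that by auto
  show "\<eta> (prv x) = 1" if "x \<in> torus N" "\<eta> x = 0"
    using e[of "prv x"] v[of "prv x"] that by auto
qed

section \<open>Jumps within the ergodic component\<close>

definition jumps :: "(int \<times> int) set" where "jumps = torus N \<times> {1, -1}"

definition jump_rate :: "int \<times> int \<Rightarrow> config \<Rightarrow> real" where
  "jump_rate = (\<lambda>(x, z) \<eta>. real (\<eta> x) * real (\<eta> ((x - z) mod int N)) * (1 - real (\<eta> ((x + z) mod int N))))"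

definition jump :: "int \<times> int \<Rightarrow> config \<Rightarrow> config" where
  "jump = (\<lambda>(x, z) \<eta>. exchange \<eta> x ((x + z) mod int N))"

lemma fep_eq: "fep_generator N f \<eta> = (\<Sum>i\<in>jumps. jump_rate i \<eta> * (f (jump i \<eta>) - f \<eta>))"
  using jump_generator.L_eq[OF fep_jump_generator, of N f \<eta>]
  by (simp add: jumps_def jump_rate_def jump_def case_prod_beta)

lemma sum_jumps: "(\<Sum>i\<in>jumps. f i) = (\<Sum>x\<in>torus N. f (x, 1) + f (x, - 1))"
  using sum.cartesian_product[of "\<lambda>x z. f (x, z)" "{1, -1}" "torus N"] by (simp add: jumps_def)

lemma finite_jumps [simp]: "finite jumps"
  by (simp add: jumps_def)

lemma jump_rate_simps:
  "jump_rate (x, 1) \<eta> = real (\<eta> x) * real (\<eta> (prv x)) * (1 - real (\<eta> (nxt x)))"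
  "jump_rate (x, - 1) \<eta> = real (\<eta> x) * real (\<eta> (nxt x)) * (1 - real (\<eta> (prv x)))"
  by (simp_all add: jump_rate_def nxt_def prv_def)

lemma jump_simps: "jump (x, 1) \<eta> = exchange \<eta> x (nxt x)" "jump (x, - 1) \<eta> = exchange \<eta> x (prv x)"
  by (simp_all add: jump_def nxt_def prv_def)

lemma jump_cases:
  assumes "i \<in> jumps" "\<eta> \<in> ergodic N K" "jump_rate i \<eta> \<noteq> 0"
  obtains (right) x where "i = (x, 1)" "x \<in> torus N" "\<eta> (prv x) = 1" "\<eta> x = 1" "\<eta> (nxt x) = 0"
      "jump i \<eta> = \<eta>(x := 0, nxt x := 1)"
  | (left) x where "i = (x, - 1)" "x \<in> torus N" "\<eta> (nxt x) = 1" "\<eta> x = 1" "\<eta> (prv x) = 0"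
      "jump i \<eta> = \<eta>(x := 0, prv x := 1)"
proof -
  obtain x z where i: "i = (x, z)" "x \<in> torus N" "z = 1 \<or> z = - 1"
    using assms(1) by (auto simp: jumps_def)
  have v: "\<eta> y = 0 \<or> \<eta> y = 1" if "y \<in> torus N" for y
    using ergodicD(3)[OF assms(2) that] .
  show ?thesis
    using i(3)
  proof
    assume "z = 1"
    thus ?thesis
      using assms(3) i v[of x] v[of "nxt x"] v[of "prv x"]
      by (intro right[of x]) (auto simp: jump_rate_simps jump_simps exchange_def)
  next
    assume "z = - 1"
    thus ?thesis
      using assms(3) i v[of x] v[of "nxt x"] v[of "prv x"]
      by (intro left[of x]) (auto simp: jump_rate_simps jump_simps exchange_def)
  qed
qed

lemma jump_rate_range:
  assumes "i \<in> jumps" "\<eta> \<in> ergodic N K"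
  shows "jump_rate i \<eta> \<in> {0, 1}"
  using assms
  by (cases "jump_rate i \<eta> = 0") (auto elim!: jump_cases simp: jump_rate_simps)

text \<open>The new hole is at \<open>x\<close>. One neighbour holds the particle that facilitated
  the jump, the other the particle that has just jumped, so no two holes become adjacent.\<close>

lemma jump_ergodic:
  assumes "i \<in> jumps" "\<eta> \<in> ergodic N K" "jump_rate i \<eta> \<noteq> 0"
  shows "jump i \<eta> \<in> ergodic N K"
proof -
  have "jump i \<eta> \<in> configs N K"
    using jump_generator.closed[OF fep_jump_generator, of i N \<eta> K] assms ergodicD(1)[OF assms(2)]
    by (auto simp: jumps_def jump_rate_def jump_def split: prod.splits)
  moreover have "jump i \<eta> y + jump i \<eta> (nxt y) \<ge> 1" if y: "y \<in> torus N" for y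
  proof -
    have e: "\<eta> y + \<eta> (nxt y) \<ge> 1"
      using assms(2) y by (auto simp: ergodic_def nxt_def)
    show ?thesis
      using assms
    proof (cases rule: jump_cases)
      case (right x)
      thus ?thesis using e y by (auto simp: nxt_eq_iff nxt_inj)
    next
      case (left x)
      thus ?thesis using e y by (auto simp: nxt_eq_iff nxt_inj)
    qed
  qed
  ultimately show ?thesis by (auto simp: ergodic_def nxt_def)
qed

section \<open>The number of available jumps\<close>

definition num_moves :: real where
  "num_moves = real (min (2 * K - N) (N - K))"

lemma real_num_moves: "num_moves = min (2 * real K - real N) (real N - real K)"
  using size by (auto simp: num_moves_def of_nat_diff min_def)

lemma sum_occupation:
  assumes "\<eta> \<in> ergodic N K"
  shows "(\<Sum>x\<in>torus N. real (\<eta> x)) = real K"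
  using ergodicD(2)[OF assms] by (simp flip: of_nat_sum)

text \<open>Two counts. A jump needs a pair of adjacent particles, usable in two directions; as
  holes are never adjacent, \<open>\<eta> x + \<eta> (prv x) - 1\<close> is the indicator of such a
  pair, and there are \<open>2 * K - N\<close> of them. A jump also fills one of the
  \<open>N - K\<close> holes, from one of two sides.\<close>

lemma sum_jump_rate:
  assumes "\<eta> \<in> ergodic N K"
  shows "(\<Sum>i\<in>jumps. jump_rate i \<eta>) \<le> 2 * num_moves"
proof -
  have v: "\<eta> x = 0 \<or> \<eta> x = 1" "\<eta> x = 0 \<Longrightarrow> \<eta> (nxt x) = 1" "\<eta> x = 0 \<Longrightarrow> \<eta> (prv x) = 1"
    "\<eta> (nxt x) = 0 \<or> \<eta> (nxt x) = 1" "\<eta> (prv x) = 0 \<or> \<eta> (prv x) = 1"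
    if "x \<in> torus N" for x
    using ergodicD[OF assms] that by auto
  have sums: "(\<Sum>x\<in>torus N. real (\<eta> (nxt x))) = real K" "(\<Sum>x\<in>torus N. real (\<eta> (prv x))) = real K"
    using sum_occupation[OF assms] sum_nxt[of "\<lambda>x. real (\<eta> x)"] sum_prv[of "\<lambda>x. real (\<eta> x)"] by auto
  have "(\<Sum>i\<in>jumps. jump_rate i \<eta>) \<le>
      (\<Sum>x\<in>torus N. (real (\<eta> x) + real (\<eta> (prv x)) - 1) + (real (\<eta> x) + real (\<eta> (nxt x)) - 1))"
    unfolding sum_jumps jump_rate_simps
  proof (intro sum_mono)
    fix x assume "x \<in> torus N"
    thus "real (\<eta> x) * real (\<eta> (prv x)) * (1 - real (\<eta> (nxt x))) +
         real (\<eta> x) * real (\<eta> (nxt x)) * (1 - real (\<eta> (prv x)))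
         \<le> real (\<eta> x) + real (\<eta> (prv x)) - 1 + (real (\<eta> x) + real (\<eta> (nxt x)) - 1)"
      using v[of x] by fastforce
  qed
  also have "\<dots> = 2 * (2 * real K - real N)"
    using sums sum_occupation[OF assms] by (simp only: sum.distrib sum_subtractf) simp
  finally have 1: "(\<Sum>i\<in>jumps. jump_rate i \<eta>) \<le> 2 * (2 * real K - real N)" .
  have "(\<Sum>i\<in>jumps. jump_rate i \<eta>) \<le>
      (\<Sum>x\<in>torus N. (1 - real (\<eta> (nxt x))) + (1 - real (\<eta> (prv x))))"
    unfolding sum_jumps jump_rate_simps
  proof (intro sum_mono)
    fix x assume "x \<in> torus N"
    thus "real (\<eta> x) * real (\<eta> (prv x)) * (1 - real (\<eta> (nxt x))) +
         real (\<eta> x) * real (\<eta> (nxt x)) * (1 - real (\<eta> (prv x)))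
         \<le> 1 - real (\<eta> (nxt x)) + (1 - real (\<eta> (prv x)))"
      using v[of x] by fastforce
  qed
  also have "\<dots> = 2 * (real N - real K)"
    using sums by (simp only: sum.distrib sum_subtractf) simp
  finally show ?thesis using 1 by (simp add: real_num_moves min_def)
qed

section \<open>The Fourier mode and the lifted process\<close>

definition \<omega> :: complex where "\<omega> = cis (2 * pi / real K)"

text \<open>Equal to \<open>2 - 2 * cos (2 * pi / K)\<close>, the decay rate of the first Fourier
  mode of the rate-one symmetric walk on the cycle of length \<open>K\<close>.\<close>

definition gap :: real where "gap = (norm (1 - \<omega>))\<^sup>2"

lemma \<omega>_cnj [simp]: "\<omega> * cnj \<omega> = 1" "cnj \<omega> * \<omega> = 1" "norm \<omega> = 1" "x * \<omega> * cnj \<omega> = x" "x * cnj \<omega> * \<omega> = x"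
    "\<omega> * (cnj \<omega> * x) = x" "cnj \<omega> * (\<omega> * x) = x"
proof -
  show inv: "\<omega> * cnj \<omega> = 1" "cnj \<omega> * \<omega> = 1" by (simp_all add: \<omega>_def cis_cnj cis_mult)
  show "x * \<omega> * cnj \<omega> = x" "x * cnj \<omega> * \<omega> = x" by (simp_all add: inv mult.assoc)
  show "\<omega> * (cnj \<omega> * x) = x" "cnj \<omega> * (\<omega> * x) = x" by (simp_all add: inv mult.assoc[symmetric])
  show "norm \<omega> = 1" by (simp add: \<omega>_def)
qed

lemma gap_complex: "complex_of_real gap = (1 - \<omega>) * (1 - cnj \<omega>)"
  using complex_norm_square[of "1 - \<omega>"] by (simp add: gap_def)

lemma gap_bounds: "0 \<le> gap" "gap \<le> 4"
proof -
  have "norm (1 - \<omega>) \<le> 1 + 1" using norm_triangle_ineq4[of 1 \<omega>] by simp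
  hence "(norm (1 - \<omega>))\<^sup>2 \<le> 2\<^sup>2" by (intro power_mono) auto
  thus "gap \<le> 4" by (simp add: gap_def)
qed (simp add: gap_def)

type_synonym lifted_config = "config \<times> (int \<Rightarrow> complex)"

text \<open>
  The phase \<open>w x\<close> is \<open>\<omega>\<close> to the number of particles up to \<open>x\<close>, counted from a moving origin. Only
  its increments are prescribed, so that a jump changes \<open>w\<close> at the single site to the left of the
  bond that is crossed, with no special case at the end of the torus.
\<close>

definition lifted :: "lifted_config set" where
  "lifted = {(\<eta>, w). \<eta> \<in> ergodic N K \<and> (\<forall>x\<in>torus N. norm (w x) = 1 \<and> w (nxt x) = w x * \<omega> ^ \<eta> (nxt x))}"

definition lift_jump :: "int \<times> int \<Rightarrow> lifted_config \<Rightarrow> lifted_config" where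
  "lift_jump = (\<lambda>(x, z) (\<eta>, w). (jump (x, z) \<eta>,
     if z = 1 then w(x := w x * cnj \<omega>) else w(prv x := w (prv x) * \<omega>)))"

definition lift_generator :: "(lifted_config \<Rightarrow> real) \<Rightarrow> lifted_config \<Rightarrow> real" where
  "lift_generator f s = (\<Sum>i\<in>jumps. jump_rate i (fst s) * (f (lift_jump i s) - f s))"

lemma fst_lift_jump [simp]: "fst (lift_jump i s) = jump i (fst s)"
  by (simp add: lift_jump_def case_prod_beta)

text \<open>A right jump takes one particle away from those up to \<open>x\<close>, a left jump adds
  one to those up to \<open>prv x\<close>. All other counts are unchanged, so correcting one phase
  restores every increment.\<close>

lemma lift_jump_lifted:
  assumes "i \<in> jumps" "s \<in> lifted" "jump_rate i (fst s) \<noteq> 0"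
  shows "lift_jump i s \<in> lifted"
proof -
  obtain \<eta> w where s: "s = (\<eta>, w)" by (cases s)
  have \<eta>: "\<eta> \<in> ergodic N K" and nw: "\<And>x. x \<in> torus N \<Longrightarrow> norm (w x) = 1"
    and w: "\<And>x. x \<in> torus N \<Longrightarrow> w (nxt x) = w x * \<omega> ^ \<eta> (nxt x)"
    using assms(2) by (auto simp: s lifted_def)
  have w': "w x = w (prv x) * \<omega> ^ \<eta> x" if "x \<in> torus N" for x
    using w[of "prv x"] that by simp
  have r: "jump_rate i \<eta> \<noteq> 0" using assms(3) by (simp add: s)
  have erg: "jump i \<eta> \<in> ergodic N K" by (rule jump_ergodic[OF assms(1) \<eta> r])
  show ?thesis
    using assms(1) \<eta> r
  proof (cases rule: jump_cases)
    case (right x)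
    show ?thesis
      unfolding lifted_def s lift_jump_def right(1)
      using erg w w'[of x] w[of x] nw right
      by (auto simp: nxt_eq_iff nxt_inj norm_mult)
  next
    case (left x)
    show ?thesis
      unfolding lifted_def s lift_jump_def left(1)
      using erg w w'[of "prv x"] w'[of x] w[of x] nw left
      by (auto simp: nxt_eq_iff nxt_inj norm_mult)
  qed
qed

sublocale lift: jump_generator lift_generator lifted jumps "\<lambda>i s. jump_rate i (fst s)" lift_jump
proof
  fix i s assume "i \<in> jumps" "s \<in> lifted"
  hence "jump_rate i (fst s) \<in> {0, 1}" by (intro jump_rate_range) (auto simp: lifted_def)
  thus "0 \<le> jump_rate i (fst s) \<and> jump_rate i (fst s) \<le> 1" by auto
qed (auto simp: lift_generator_def lift_jump_lifted)

lemma lift_generator_fst: "lift_generator (\<lambda>s. f (fst s)) = (\<lambda>s. fep_generator N f (fst s))"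
  by (simp add: fun_eq_iff lift_generator_def fep_eq)

lemma semigroup_lift: "semigroup lift_generator t (\<lambda>s. f (fst s)) s = semigroup (fep_generator N) t f (fst s)"
proof -
  have "(lift_generator ^^ n) (\<lambda>s. f (fst s)) = (\<lambda>s. (fep_generator N ^^ n) f (fst s))" for n
    by (induction n) (simp_all add: lift_generator_fst)
  thus ?thesis by (simp add: semigroup_def)
qed

text \<open>
  Labelling each hole by the number of particles before it turns the holes into an exclusion
  process on \<open>\<int> / K\<int>\<close>; \<open>hole_sum\<close> is the first Fourier coefficient of that process.
\<close>

definition hole_sum :: "lifted_config \<Rightarrow> complex" where
  "hole_sum s = (\<Sum>x\<in>torus N. (1 - of_nat (fst s x)) * snd s x)"

definition increment :: "int \<times> int \<Rightarrow> lifted_config \<Rightarrow> complex" where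
  "increment i s = - of_int (snd i) * snd s (fst i) * (1 - cnj \<omega>)"

text \<open>In a right jump the hole moves from \<open>nxt x\<close>, where the phase is
  \<open>w x\<close>, to \<open>x\<close>, where it becomes \<open>w x * cnj \<omega>\<close>. In a
  left jump it moves from \<open>prv x\<close>, with phase \<open>w x * cnj \<omega>\<close>, to
  \<open>x\<close>, with phase \<open>w x\<close>. So the label of one hole changes by one.\<close>

lemma hole_sum_jump:
  assumes "i \<in> jumps" "s \<in> lifted" "jump_rate i (fst s) \<noteq> 0"
  shows "hole_sum (lift_jump i s) = hole_sum s + increment i s"
proof -
  obtain \<eta> w where s: "s = (\<eta>, w)" by (cases s)
  have \<eta>: "\<eta> \<in> ergodic N K" and w: "\<And>x. x \<in> torus N \<Longrightarrow> w (nxt x) = w x * \<omega> ^ \<eta> (nxt x)"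
    using assms(2) by (auto simp: s lifted_def)
  have r: "jump_rate i \<eta> \<noteq> 0" using assms(3) by (simp add: s)
  define d where "d y = (1 - of_nat (fst (lift_jump i s) y)) * snd (lift_jump i s) y - (1 - of_nat (\<eta> y)) * w y" for y
  have diff: "hole_sum (lift_jump i s) = hole_sum s + (\<Sum>y\<in>T. d y)"
    if "T \<subseteq> torus N" "\<And>y. y \<in> torus N - T \<Longrightarrow> d y = 0" for T
  proof -
    have "(\<Sum>y\<in>T. d y) = (\<Sum>y\<in>torus N. d y)"
      using that by (intro sum.mono_neutral_left) auto
    thus ?thesis by (simp add: d_def sum_subtractf hole_sum_def s)
  qed
  show ?thesis
    using assms(1) \<eta> r
  proof (cases rule: jump_cases)
    case (right x)
    have "hole_sum (lift_jump i s) = hole_sum s + (\<Sum>y\<in>{x, nxt x}. d y)"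
      using right by (intro diff) (auto simp: d_def s lift_jump_def)
    also have "(\<Sum>y\<in>{x, nxt x}. d y) = increment i s"
      using right w[of x] by (simp add: d_def s lift_jump_def increment_def algebra_simps)
    finally show ?thesis .
  next
    case (left x)
    have "hole_sum (lift_jump i s) = hole_sum s + (\<Sum>y\<in>{x, prv x}. d y)"
      using left by (intro diff) (auto simp: d_def s lift_jump_def)
    also have "(\<Sum>y\<in>{x, prv x}. d y) = increment i s"
      using left w[of "prv x"] by (simp add: d_def s lift_jump_def increment_def algebra_simps)
    finally show ?thesis .
  qed
qed

lemma norm_increment:
  assumes "i \<in> jumps" "s \<in> lifted"
  shows "(norm (increment i s))\<^sup>2 = gap"
proof -
  have "norm (1 - cnj \<omega>) = norm (1 - \<omega>)" using complex_mod_cnj[of "1 - \<omega>"] by simp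
  thus ?thesis
    using assms by (auto simp: increment_def norm_mult gap_def jumps_def lifted_def)
qed

lemma lift_generator_jump:
  assumes "s \<in> lifted"
  shows "lift_generator (\<lambda>s. g (hole_sum s)) s =
    (\<Sum>i\<in>jumps. jump_rate i (fst s) * (g (hole_sum s + increment i s) - g (hole_sum s)))"
  unfolding lift_generator_def
proof (intro sum.cong refl)
  fix i assume "i \<in> jumps"
  thus "jump_rate i (fst s) * (g (hole_sum (lift_jump i s)) - g (hole_sum s)) =
     jump_rate i (fst s) * (g (hole_sum s + increment i s) - g (hole_sum s))"
    using hole_sum_jump[OF _ assms] by (cases "jump_rate i (fst s) = 0") auto
qed

text \<open>The facilitation products cancel between the two directions, leaving a linear gradient;
  summation by parts turns it into a Laplacian acting on the mode.\<close>

lemma hole_sum_drift: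
  assumes "s \<in> lifted"
  shows "(\<Sum>i\<in>jumps. of_real (jump_rate i (fst s)) * increment i s) = - of_real gap * hole_sum s"
proof -
  obtain \<eta> w where s: "s = (\<eta>, w)" by (cases s)
  have \<eta>: "\<eta> \<in> ergodic N K" and w: "\<And>x. x \<in> torus N \<Longrightarrow> w (nxt x) = w x * \<omega> ^ \<eta> (nxt x)"
    using assms by (auto simp: s lifted_def)
  let ?e = "\<lambda>x. of_nat (\<eta> x) :: complex"
  have v: "\<eta> x = 0 \<or> \<eta> x = 1" "\<eta> x = 0 \<Longrightarrow> \<eta> (nxt x) = 1" "\<eta> x = 0 \<Longrightarrow> \<eta> (prv x) = 1"
    "\<eta> (nxt x) = 0 \<or> \<eta> (nxt x) = 1" "\<eta> (prv x) = 0 \<or> \<eta> (prv x) = 1"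
    if "x \<in> torus N" for x
    using ergodicD[OF \<eta>] that by auto
  have "(\<Sum>i\<in>jumps. of_real (jump_rate i \<eta>) * increment i s) =
      (\<Sum>x\<in>torus N. (1 - cnj \<omega>) * ((1 - ?e (prv x)) * w x - (1 - ?e (nxt x)) * w x))"
    unfolding sum_jumps
  proof (intro sum.cong refl)
    fix x assume "x \<in> torus N"
    thus "of_real (jump_rate (x, 1) \<eta>) * increment (x, 1) s + of_real (jump_rate (x, - 1) \<eta>) * increment (x, - 1) s
      = (1 - cnj \<omega>) * ((1 - ?e (prv x)) * w x - (1 - ?e (nxt x)) * w x)"
      using v[of x] by (auto simp: jump_rate_simps increment_def s algebra_simps)
  qed
  also have "\<dots> = (1 - cnj \<omega>) * ((\<Sum>x\<in>torus N. (1 - ?e (prv x)) * w x) - (\<Sum>x\<in>torus N. (1 - ?e (nxt x)) * w x))"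
    by (simp only: sum_distrib_left[symmetric] sum_subtractf)
  also have "(\<Sum>x\<in>torus N. (1 - ?e (prv x)) * w x) = (\<Sum>x\<in>torus N. (1 - ?e x) * w (nxt x))"
    using sum_nxt[of "\<lambda>x. (1 - ?e (prv x)) * w x"] by simp
  also have "(\<Sum>x\<in>torus N. (1 - ?e (nxt x)) * w x) = (\<Sum>x\<in>torus N. (1 - ?e x) * w (prv x))"
    using sum_prv[of "\<lambda>x. (1 - ?e (nxt x)) * w x"] by simp
  also have "(\<Sum>x\<in>torus N. (1 - ?e x) * w (nxt x)) - (\<Sum>x\<in>torus N. (1 - ?e x) * w (prv x)) =
      (\<Sum>x\<in>torus N. (\<omega> - 1) * ((1 - ?e x) * w x))"
    unfolding sum_subtractf[symmetric]
  proof (intro sum.cong refl)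
    fix x assume x: "x \<in> torus N"
    \<comment> \<open>Only holes contribute. At a hole \<open>w (prv x) = w x\<close>, and the next
      site is occupied, so \<open>w (nxt x) = w x * \<omega>\<close>.\<close>
    show "(1 - ?e x) * w (nxt x) - (1 - ?e x) * w (prv x) = (\<omega> - 1) * ((1 - ?e x) * w x)"
      using v[OF x] w[OF x] w[of "prv x"] x by (cases "\<eta> x = 0") (auto simp: algebra_simps)
  qed
  also have "\<dots> = (\<omega> - 1) * hole_sum s" by (simp add: hole_sum_def s sum_distrib_left)
  finally show ?thesis by (simp add: s gap_complex algebra_simps)
qed

section \<open>First and second moments of the Fourier mode\<close>

lemma lift_generator_Re:
  assumes "s \<in> lifted"
  shows "lift_generator (\<lambda>s. Re (hole_sum s)) s = - gap * Re (hole_sum s)"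
proof -
  have "lift_generator (\<lambda>s. Re (hole_sum s)) s = Re (\<Sum>i\<in>jumps. of_real (jump_rate i (fst s)) * increment i s)"
    by (subst lift_generator_jump[OF assms]) simp
  thus ?thesis by (simp add: hole_sum_drift[OF assms])
qed

text \<open>The cross term of the expanded square is given by the drift. The quadratic term is at
  most \<open>gap\<close> per jump, with total rate at most \<open>2 * num_moves\<close>, which
  yields \<open>V = num_moves\<close> in \<open>eigenfunction_tail\<close>.\<close>

lemma lift_generator_Re_power2:
  assumes "s \<in> lifted"
  shows "lift_generator (\<lambda>s. (Re (hole_sum s))\<^sup>2) s \<le> - (2 * gap) * (Re (hole_sum s))\<^sup>2 + 2 * gap * num_moves"
proof -
  let ?R = "Re (hole_sum s)" and ?r = "\<lambda>i. jump_rate i (fst s)"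
  have erg: "fst s \<in> ergodic N K" using assms by (auto simp: lifted_def)
  have "lift_generator (\<lambda>s. (Re (hole_sum s))\<^sup>2) s =
     (\<Sum>i\<in>jumps. 2 * ?R * (?r i * (Re (increment i s))) + ?r i * (Re (increment i s))\<^sup>2)"
    by (subst lift_generator_jump[OF assms]) (auto intro!: sum.cong simp: power2_eq_square algebra_simps)
  also have "\<dots> = 2 * ?R * Re (\<Sum>i\<in>jumps. of_real (?r i) * increment i s) + (\<Sum>i\<in>jumps. ?r i * (Re (increment i s))\<^sup>2)"
    by (simp add: sum.distrib sum_distrib_left)
  also have "(\<Sum>i\<in>jumps. ?r i * (Re (increment i s))\<^sup>2) \<le> (\<Sum>i\<in>jumps. ?r i * gap)"
  proof (intro sum_mono mult_left_mono)
    fix i assume i: "i \<in> jumps"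
    show "(Re (increment i s))\<^sup>2 \<le> gap"
      using norm_increment[OF i assms] by (simp add: cmod_power2 flip: norm_increment[OF i assms])
    show "0 \<le> ?r i" using jump_rate_range[OF i erg] by auto
  qed
  also have "\<dots> = (\<Sum>i\<in>jumps. ?r i) * gap" by (simp add: sum_distrib_right)
  also have "\<dots> \<le> 2 * num_moves * gap"
    using sum_jump_rate[OF erg] gap_bounds by (intro mult_right_mono) auto
  finally show ?thesis
    unfolding hole_sum_drift[OF assms] by (simp add: power2_eq_square algebra_simps)
qed

text \<open>Counterpart for the modulus, which depends on the configuration alone and can therefore
  be averaged over the equilibrium measure.\<close>

lemma lift_generator_norm_power2:
  assumes "s \<in> lifted"
  shows "lift_generator (\<lambda>s. (norm (hole_sum s))\<^sup>2) s \<le> - (2 * gap) * (norm (hole_sum s))\<^sup>2 + 2 * gap * num_moves"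
proof -
  let ?F = "hole_sum s" and ?r = "\<lambda>i. jump_rate i (fst s)"
  have erg: "fst s \<in> ergodic N K" using assms by (auto simp: lifted_def)
  have "lift_generator (\<lambda>s. (norm (hole_sum s))\<^sup>2) s =
     (\<Sum>i\<in>jumps. ?r i * ((norm (?F + increment i s))\<^sup>2 - (norm ?F)\<^sup>2))"
    by (rule lift_generator_jump[OF assms])
  also have "\<dots> = (\<Sum>i\<in>jumps. 2 * Re (cnj ?F * (of_real (?r i) * increment i s)) + ?r i * gap)"
  proof (intro sum.cong refl)
    fix i assume i: "i \<in> jumps"
    show "?r i * ((norm (?F + increment i s))\<^sup>2 - (norm ?F)\<^sup>2)
       = 2 * Re (cnj ?F * (of_real (?r i) * increment i s)) + ?r i * gap"
      unfolding norm_increment[OF i assms, symmetric] cmod_power2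
      by (simp add: power2_eq_square algebra_simps)
  qed
  also have "\<dots> = 2 * Re (cnj ?F * (\<Sum>i\<in>jumps. of_real (?r i) * increment i s)) + (\<Sum>i\<in>jumps. ?r i) * gap"
    by (simp add: sum.distrib sum_distrib_left sum_distrib_right del: times_complex.sel)
  also have "(\<Sum>i\<in>jumps. ?r i) * gap \<le> 2 * num_moves * gap"
    using sum_jump_rate[OF erg] gap_bounds by (intro mult_right_mono) auto
  also have "Re (cnj ?F * (\<Sum>i\<in>jumps. of_real (?r i) * increment i s)) = - gap * (norm ?F)\<^sup>2"
    unfolding hole_sum_drift[OF assms] cmod_power2 by (simp add: power2_eq_square algebra_simps)
  finally show ?thesis by (simp add: algebra_simps)
qed

section \<open>Equilibrium and mixing\<close>

definition phase :: "config \<Rightarrow> int \<Rightarrow> complex" where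
  "phase \<eta> x = \<omega> ^ (\<Sum>y\<in>{0..x}. \<eta> y)"

lemma \<omega>_power_K: "\<omega> ^ K = 1"
  using size by (simp add: \<omega>_def Complex.DeMoivre)

lemma phase_lifted:
  assumes "\<eta> \<in> ergodic N K"
  shows "(\<eta>, phase \<eta>) \<in> lifted"
proof -
  have "phase \<eta> (nxt x) = phase \<eta> x * \<omega> ^ \<eta> (nxt x)" if x: "x \<in> torus N" for x
  proof (cases "x = int N - 1")
    case True
    have "{0..x} = torus N" using True by (auto simp: torus_def)
    \<comment> \<open>At the last site all \<open>K\<close> particles have been counted, and
      \<open>\<omega> ^ K = 1\<close> closes the cycle.\<close>
    hence "phase \<eta> x = 1" using ergodicD(2)[OF assms] by (simp add: phase_def \<omega>_power_K)
    thus ?thesis using True nxt_eq[OF x] by (simp add: phase_def)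
  next
    case False
    have "{0..x + 1} = insert (x + 1) {0..x}" using x by (auto simp: torus_def)
    thus ?thesis using False nxt_eq[OF x] by (simp add: phase_def power_add)
  qed
  thus ?thesis using assms by (auto simp: lifted_def phase_def norm_power)
qed

lemma lifted_phase_unique:
  assumes "(\<eta>, w) \<in> lifted" "(\<eta>, v) \<in> lifted" "x \<in> torus N"
  shows "w x = w 0 * cnj (v 0) * v x"
proof -
  have z: "0 \<in> torus N" using size by (simp add: torus_def)
  have "w (int n) = w 0 * cnj (v 0) * v (int n)" if "n < N" for n
    using that
  proof (induction n)
    case 0
    have "cnj (v 0) * v 0 = 1"
      using assms(2) z complex_norm_square[of "v 0"] by (auto simp: lifted_def mult.commute)
    thus ?case by (simp add: mult.assoc)
  next
    case (Suc n)
    have n: "int n \<in> torus N" "nxt (int n) = int (Suc n)"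
      using Suc.prems nxt_eq[of "int n"] by (auto simp: torus_def)
    have "w (int (Suc n)) = w (int n) * \<omega> ^ \<eta> (int (Suc n))"
      "v (int (Suc n)) = v (int n) * \<omega> ^ \<eta> (int (Suc n))"
      using assms(1,2) n by (auto simp: lifted_def)
    thus ?case using Suc by simp
  qed
  from this[of "nat x"] show ?thesis using assms(3) by (simp add: torus_def nat_less_iff)
qed

definition amplitude :: "config \<Rightarrow> real" where
  "amplitude \<eta> = norm (hole_sum (\<eta>, phase \<eta>))"

text \<open>Two lifts of a configuration differ by a global rotation, which the modulus
  ignores.\<close>

lemma amplitude_eq:
  assumes "s \<in> lifted"
  shows "amplitude (fst s) = norm (hole_sum s)"
proof -
  obtain \<eta> w where s: "s = (\<eta>, w)" by (cases s)
  let ?v = "phase \<eta>"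
  have v: "(\<eta>, ?v) \<in> lifted" using assms by (intro phase_lifted) (auto simp: s lifted_def)
  have w: "(\<eta>, w) \<in> lifted" using assms s by simp
  have "hole_sum s = (\<Sum>x\<in>torus N. w 0 * cnj (?v 0) * ((1 - of_nat (\<eta> x)) * ?v x))"
    unfolding hole_sum_def s
  proof (intro sum.cong refl)
    fix x assume "x \<in> torus N"
    note eq = lifted_phase_unique[OF w v this]
    show "(1 - of_nat (fst (\<eta>, w) x)) * snd (\<eta>, w) x = w 0 * cnj (?v 0) * ((1 - of_nat (\<eta> x)) * ?v x)"
      unfolding fst_conv snd_conv by (subst eq) (simp only: mult_ac)
  qed
  also have "\<dots> = w 0 * cnj (?v 0) * hole_sum (\<eta>, ?v)" by (simp add: hole_sum_def sum_distrib_left)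
  finally show ?thesis
    using v w size by (auto simp: amplitude_def s norm_mult lifted_def torus_def)
qed

text \<open>A global rotation aligns the Fourier coefficient with the positive real axis, so its
  real part starts at the full amplitude.\<close>

lemma lifted_real_start:
  assumes "\<eta> \<in> ergodic N K"
  obtains w where "(\<eta>, w) \<in> lifted" "hole_sum (\<eta>, w) = of_real (amplitude \<eta>)"
proof
  let ?F = "hole_sum (\<eta>, phase \<eta>)"
  \<comment> \<open>The case split keeps the rotation of modulus 1, since
    \<open>sgn 0 = 0\<close>.\<close>
  let ?\<kappa> = "if ?F = 0 then 1 else cnj (sgn ?F)"
  have "norm ?\<kappa> = 1" by (simp add: norm_sgn)
  thus "(\<eta>, \<lambda>x. ?\<kappa> * phase \<eta> x) \<in> lifted"
    using phase_lifted[OF assms] by (auto simp: lifted_def norm_mult)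
  have "hole_sum (\<eta>, \<lambda>x. ?\<kappa> * phase \<eta> x) = ?\<kappa> * ?F"
    unfolding hole_sum_def sum_distrib_left by (simp add: mult_ac)
  also have "\<dots> = of_real (norm ?F)"
    using complex_norm_square[of ?F]
    by (simp add: sgn_eq field_simps power2_eq_square)
  finally show "hole_sum (\<eta>, \<lambda>x. ?\<kappa> * phase \<eta> x) = of_real (amplitude \<eta>)"
    by (simp add: amplitude_def)
qed

section \<open>Reversibility and the equilibrium second moment\<close>

definition rev_jump :: "int \<times> int \<Rightarrow> int \<times> int" where
  "rev_jump = (\<lambda>(x, z). ((x + z) mod int N, - z))"

lemma rev_jump_simps: "rev_jump (x, 1) = (nxt x, - 1)" "rev_jump (x, - 1) = (prv x, 1)"
  by (simp_all add: rev_jump_def nxt_def prv_def)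

lemma rev_jump: "i \<in> jumps \<Longrightarrow> rev_jump i \<in> jumps" "i \<in> jumps \<Longrightarrow> rev_jump (rev_jump i) = i"
  by (auto simp: jumps_def rev_jump_simps)

text \<open>The return jump is facilitated by the particle on the far side of the filled hole, which
  is there because holes are never adjacent.\<close>

lemma jump_reversible:
  assumes "i \<in> jumps" "\<eta> \<in> ergodic N K" "jump_rate i \<eta> \<noteq> 0"
  shows "jump (rev_jump i) (jump i \<eta>) = \<eta>" "jump_rate (rev_jump i) (jump i \<eta>) = jump_rate i \<eta>"
proof -
  have "jump (rev_jump i) (jump i \<eta>) = \<eta> \<and> jump_rate (rev_jump i) (jump i \<eta>) = jump_rate i \<eta>"
    using assms
  proof (cases rule: jump_cases)
    case (right x)
    have "\<eta> (nxt (nxt x)) = 1" using ergodicD(4)[OF assms(2), of "nxt x"] right by simp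
    moreover have "nxt (nxt x) \<noteq> x" "nxt (nxt x) \<noteq> nxt x"
      using right nxt_prv_simps(7)[of "nxt x"] nxt_prv_simps(5)[of "nxt x"] by auto
    ultimately show ?thesis
      using right by (auto simp: rev_jump_simps jump_rate_simps jump_simps exchange_def)
  next
    case (left x)
    have "\<eta> (prv (prv x)) = 1" using ergodicD(5)[OF assms(2), of "prv x"] left by simp
    moreover have "prv (prv x) \<noteq> x" "prv (prv x) \<noteq> prv x"
      using left nxt_prv_simps(7)[of "prv x"] nxt_prv_simps(6)[of "prv x"] by auto
    ultimately show ?thesis
      using left by (auto simp: rev_jump_simps jump_rate_simps jump_simps exchange_def)
  qed
  thus "jump (rev_jump i) (jump i \<eta>) = \<eta>" "jump_rate (rev_jump i) (jump i \<eta>) = jump_rate i \<eta>"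
    by auto
qed

text \<open>Invariance of the uniform measure: pairing each jump with its reverse cancels gain
  against loss.\<close>

lemma sum_fep_generator: "(\<Sum>\<eta>\<in>ergodic N K. fep_generator N f \<eta>) = 0"
proof -
  let ?E = "ergodic N K" and ?D = "\<lambda>i. {\<eta> \<in> ergodic N K. jump_rate i \<eta> \<noteq> 0}"
  have restrict: "(\<Sum>\<eta>\<in>?E. jump_rate i \<eta> * g \<eta>) = (\<Sum>\<eta>\<in>?D i. jump_rate i \<eta> * g \<eta>)" for i g
    by (rule sum.mono_neutral_right) (auto simp: finite_ergodic)
  have flip: "(\<Sum>\<eta>\<in>?E. jump_rate i \<eta> * f (jump i \<eta>)) = (\<Sum>\<eta>\<in>?E. jump_rate (rev_jump i) \<eta> * f \<eta>)"
    if i: "i \<in> jumps" for i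
    unfolding restrict
  proof (rule sum.reindex_bij_witness[of _ "jump (rev_jump i)" "jump i"])
    fix \<eta> assume "\<eta> \<in> ?D i"
    thus "jump (rev_jump i) (jump i \<eta>) = \<eta>" "jump i \<eta> \<in> ?D (rev_jump i)"
      "jump_rate (rev_jump i) (jump i \<eta>) * f (jump i \<eta>) = jump_rate i \<eta> * f (jump i \<eta>)"
      using jump_reversible[OF i] jump_ergodic[OF i] by auto
  next
    fix \<eta> assume "\<eta> \<in> ?D (rev_jump i)"
    thus "jump i (jump (rev_jump i) \<eta>) = \<eta>" "jump (rev_jump i) \<eta> \<in> ?D i"
      using jump_reversible[OF rev_jump(1)[OF i]] jump_ergodic[OF rev_jump(1)[OF i]] rev_jump(2)[OF i]
      by auto
  qed
  have "(\<Sum>\<eta>\<in>?E. fep_generator N f \<eta>) =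
      (\<Sum>i\<in>jumps. \<Sum>\<eta>\<in>?E. jump_rate i \<eta> * f (jump i \<eta>)) - (\<Sum>i\<in>jumps. \<Sum>\<eta>\<in>?E. jump_rate i \<eta> * f \<eta>)"
    unfolding fep_eq right_diff_distrib sum_subtractf by (subst (1 2) sum.swap) (rule refl)
  also have "(\<Sum>i\<in>jumps. \<Sum>\<eta>\<in>?E. jump_rate i \<eta> * f (jump i \<eta>)) =
      (\<Sum>i\<in>jumps. \<Sum>\<eta>\<in>?E. jump_rate (rev_jump i) \<eta> * f \<eta>)"
    by (rule sum.cong) (simp_all add: flip)
  also have "\<dots> = (\<Sum>i\<in>jumps. \<Sum>\<eta>\<in>?E. jump_rate i \<eta> * f \<eta>)"
    by (rule sum.reindex_bij_witness[of _ rev_jump rev_jump]) (auto simp: rev_jump)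
  finally show ?thesis by simp
qed

lemma norm_one_minus_\<omega>: "norm (1 - \<omega>) = 2 * sin (pi / real K)" "0 < sin (pi / real K)"
proof -
  have "0 < pi / real K" "pi / real K < pi" using size by (auto simp: field_simps)
  thus pos: "0 < sin (pi / real K)" by (rule sin_gt_zero)
  thus "norm (1 - \<omega>) = 2 * sin (pi / real K)" by (simp add: \<omega>_def norm_one_minus_cis)
qed

lemma gap_pos: "0 < gap"
  using norm_one_minus_\<omega> by (simp add: gap_def)

lemma gap_le: "gap \<le> 4 * pi\<^sup>2 / (real K)\<^sup>2"
proof -
  have "norm (1 - \<omega>) \<le> 2 * pi / real K"
    using norm_one_minus_\<omega> sin_x_le_x[of "pi / real K"] by simp
  hence "gap \<le> (2 * pi / real K)\<^sup>2" unfolding gap_def by (intro power_mono) auto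
  thus ?thesis by (simp add: power_divide power_mult_distrib)
qed

lemma num_moves_ge_1: "1 \<le> num_moves"
proof -
  have "1 \<le> min (2 * K - N) (N - K)" using size by linarith
  thus ?thesis unfolding num_moves_def by linarith
qed

text \<open>Summed over the component, the drift inequality has left-hand side zero by invariance,
  and \<open>gap\<close> cancels from what remains.\<close>

lemma sum_amplitude_power2:
  "(\<Sum>\<eta>\<in>ergodic N K. (amplitude \<eta>)\<^sup>2) \<le> real (card (ergodic N K)) * num_moves"
proof -
  let ?Q = "\<lambda>\<eta>. (amplitude \<eta>)\<^sup>2"
  have L: "fep_generator N ?Q \<eta> \<le> - (2 * gap) * ?Q \<eta> + 2 * gap * num_moves"
    if \<eta>: "\<eta> \<in> ergodic N K" for \<eta>
  proof -
    note s = phase_lifted[OF \<eta>]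
    \<comment> \<open>The two functions agree only on \<open>lifted\<close>; locality of the
      generator, used with exponent 1, transfers the equality.\<close>
    have "\<forall>s\<in>lifted. (lift_generator ^^ 1) (\<lambda>s. ?Q (fst s)) s = (lift_generator ^^ 1) (\<lambda>s. (norm (hole_sum s))\<^sup>2) s"
      by (rule lift.L_pow_local) (simp add: amplitude_eq)
    hence "lift_generator (\<lambda>s. ?Q (fst s)) (\<eta>, phase \<eta>) = lift_generator (\<lambda>s. (norm (hole_sum s))\<^sup>2) (\<eta>, phase \<eta>)"
      using s by auto
    moreover have "lift_generator (\<lambda>s. ?Q (fst s)) (\<eta>, phase \<eta>) = fep_generator N ?Q \<eta>"
      using fun_cong[OF lift_generator_fst[of ?Q]] by simp
    moreover have "amplitude \<eta> = norm (hole_sum (\<eta>, phase \<eta>))" by (rule amplitude_def)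
    ultimately show ?thesis using lift_generator_norm_power2[OF s] by metis
  qed
  have "0 \<le> (\<Sum>\<eta>\<in>ergodic N K. - (2 * gap) * ?Q \<eta> + 2 * gap * num_moves)"
    unfolding sum_fep_generator[of ?Q, symmetric] using L by (rule sum_mono)
  also have "\<dots> = 2 * gap * (real (card (ergodic N K)) * num_moves - (\<Sum>\<eta>\<in>ergodic N K. ?Q \<eta>))"
    by (simp only: sum.distrib sum_distrib_left[symmetric] sum_constant) (simp add: algebra_simps)
  finally show ?thesis using gap_pos by (simp add: zero_le_mult_iff)
qed

text \<open>Markov's inequality for the squared amplitude.\<close>

lemma stationary_tail:
  assumes "0 < a"
  shows "1 - num_moves / a\<^sup>2 \<le> measure_pmf.prob (fep_stationary N K) {\<eta>. amplitude \<eta> \<le> a}"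
proof -
  let ?E = "ergodic N K" and ?T = "{\<eta>. amplitude \<eta> \<le> a}"
  have E: "?E \<noteq> {}" "finite ?E" using ergodic_nonempty finite_ergodic size by auto
  hence cE: "0 < real (card ?E)" by (simp add: card_gt_0_iff)
  have "a\<^sup>2 * real (card (?E - ?T)) = (\<Sum>\<eta>\<in>?E - ?T. a\<^sup>2)" by simp
  also have "\<dots> \<le> (\<Sum>\<eta>\<in>?E - ?T. (amplitude \<eta>)\<^sup>2)"
    using assms by (intro sum_mono power_mono) auto
  also have "\<dots> \<le> (\<Sum>\<eta>\<in>?E. (amplitude \<eta>)\<^sup>2)" using E by (intro sum_mono2) auto
  also have "\<dots> \<le> real (card ?E) * num_moves" by (rule sum_amplitude_power2)
  finally have "real (card (?E - ?T)) / real (card ?E) \<le> num_moves / a\<^sup>2"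
    using cE assms by (simp add: field_simps)
  moreover have "real (card (?E \<inter> ?T)) = real (card ?E) - real (card (?E - ?T))"
    using card_Int_Diff[OF E(2), of ?T] by simp
  ultimately have "1 - num_moves / a\<^sup>2 \<le> real (card (?E \<inter> ?T)) / real (card ?E)"
    using cE by (simp add: diff_divide_distrib)
  thus ?thesis using E by (simp add: fep_stationary_def measure_pmf_of_set)
qed

section \<open>The law at time \<open>t\<close>\<close>

lemma prob_fep_law:
  assumes "\<eta> \<in> configs N K" "0 \<le> t"
  shows "measure_pmf.prob (fep_law N \<eta> t) T = semigroup (fep_generator N) t (indicator T) \<eta>"
proof -
  interpret fep: jump_generator "fep_generator N" "configs N K" "torus N \<times> {1, -1}"
     "\<lambda>(x, z) \<eta>. real (\<eta> x) * real (\<eta> ((x - z) mod int N)) * (1 - real (\<eta> ((x + z) mod int N)))"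
     "\<lambda>(x, z) \<eta>. exchange \<eta> x ((x + z) mod int N)"
    by (rule fep_jump_generator)
  let ?C = "configs N K"
  have "set_pmf (fep_law N \<eta> t) \<subseteq> ?C"
  proof
    fix \<xi> assume "\<xi> \<in> set_pmf (fep_law N \<eta> t)"
    hence nz: "pmf (fep_law N \<eta> t) \<xi> \<noteq> 0" by (simp add: set_pmf_iff)
    show "\<xi> \<in> ?C"
    proof (rule ccontr)
      assume "\<xi> \<notin> ?C"
      hence "semigroup (fep_generator N) t (indicator {\<xi>}) \<eta> = 0"
        using assms by (intro fep.semigroup_outside) (auto simp: indicator_def)
      thus False using nz pmf_fep_law[OF assms] by simp
    qed
  qed
  hence "measure_pmf.prob (fep_law N \<eta> t) T = measure_pmf.prob (fep_law N \<eta> t) (T \<inter> ?C)"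
    by (intro measure_pmf.finite_measure_eq_AE) (auto simp: AE_measure_pmf_iff)
  also have "\<dots> = (\<Sum>\<xi>\<in>T \<inter> ?C. pmf (fep_law N \<eta> t) \<xi>)"
    by (rule measure_measure_pmf_finite) (simp add: finite_configs)
  also have "\<dots> = semigroup (fep_generator N) t (indicator (T \<inter> ?C)) \<eta>"
    using assms by (subst fep.semigroup_indicator) (auto simp: finite_configs pmf_fep_law)
  also have "\<dots> = semigroup (fep_generator N) t (indicator T) \<eta>"
    using assms(1) by (intro fep.semigroup_cong) (auto simp: indicator_def)
  finally show ?thesis .
qed

lemma bounded_hole_sum: "lift.bounded_obs (\<lambda>s. Re (hole_sum s))"
proof -
  have "\<bar>Re (hole_sum s)\<bar> \<le> real N" if s: "s \<in> lifted" for s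
  proof -
    have "norm (hole_sum s) \<le> (\<Sum>x\<in>torus N. norm ((1 - of_nat (fst s x)) * snd s x))"
      unfolding hole_sum_def by (rule norm_sum)
    also have "\<dots> \<le> (\<Sum>x\<in>torus N. 1)"
    proof (intro sum_mono)
      fix x assume x: "x \<in> torus N"
      have "fst s x = 0 \<or> fst s x = 1" "norm (snd s x) = 1"
        using s x ergodicD(3)[of "fst s" x] by (auto simp: lifted_def)
      thus "norm ((1 - of_nat (fst s x)) * snd s x) \<le> 1" by (auto simp: norm_mult)
    qed
    finally show ?thesis using abs_Re_le_cmod[of "hole_sum s"] by simp
  qed
  thus ?thesis unfolding lift.bounded_obs_def by blast
qed

text \<open>On the lift, the real part of \<open>hole_sum\<close> is an eigenfunction that never
  exceeds the amplitude and, for a suitably rotated start, equals it at time 0. A small amplitude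
  thus forces a small real part.\<close>

lemma fep_law_tail:
  assumes "\<eta> \<in> ergodic N K" "0 \<le> t" "4 \<le> N" "a < exp (- gap * t) * amplitude \<eta>"
  shows "measure_pmf.prob (fep_law N \<eta> t) {\<eta>. amplitude \<eta> \<le> a}
    \<le> num_moves / (exp (- gap * t) * amplitude \<eta> - a)\<^sup>2"
proof -
  let ?T = "{\<eta>. amplitude \<eta> \<le> a}"
  obtain w where w: "(\<eta>, w) \<in> lifted" "hole_sum (\<eta>, w) = of_real (amplitude \<eta>)"
    using lifted_real_start[OF assms(1)] .
  \<comment> \<open>With \<open>gap \<le> 4\<close>, the condition
    \<open>2 * gap \<le> lift.c\<close> follows once \<open>N\<close> is at least 4.\<close>
  have "lift.c = 2 * real N" unfolding lift.c_def by (simp add: jumps_def)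
  hence c: "2 * gap \<le> lift.c" using gap_bounds assms(3) by simp
  have "measure_pmf.prob (fep_law N \<eta> t) ?T = semigroup (fep_generator N) t (indicator ?T) \<eta>"
    using ergodicD(1)[OF assms(1)] assms(2) by (rule prob_fep_law)
  also have "\<dots> = semigroup lift_generator t (\<lambda>s. indicator ?T (fst s)) (\<eta>, w)"
    by (simp add: semigroup_lift)
  also have "(\<lambda>s. indicator ?T (fst s) :: real) = indicator {s. amplitude (fst s) \<le> a}"
    by (auto simp: indicator_def fun_eq_iff)
  also have "semigroup lift_generator t (indicator {s. amplitude (fst s) \<le> a}) (\<eta>, w)
      \<le> num_moves / (exp (- gap * t) * Re (hole_sum (\<eta>, w)) - a)\<^sup>2"
  proof (rule lift.eigenfunction_tail[OF bounded_hole_sum ballI[OF lift_generator_Re]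
        ballI[OF lift_generator_Re_power2] gap_bounds(1) c _ w(1) assms(2)])
    show "Re (hole_sum s) \<le> a" if "s \<in> lifted" "s \<in> {s. amplitude (fst s) \<le> a}" for s
      using that amplitude_eq[OF that(1)] complex_Re_le_cmod[of "hole_sum s"] by simp
  qed (use num_moves_ge_1 assms(4) w(2) in auto)
  finally show ?thesis by (simp add: w(2))
qed

text \<open>
  In this configuration the holes have the consecutive labels \<open>1, \<dots>, N - K\<close>, which makes the
  Fourier coefficient of maximal order.
\<close>

definition step_config :: config where
  "step_config = restrict (\<lambda>x. if odd x \<and> x < 2 * int (N - K) then 0 else 1) (torus N)"

lemma sum_step_config: "j \<le> N - K \<Longrightarrow> (\<Sum>y\<in>{0..<2 * int j}. step_config y) = j"
proof (induction j)
  case (Suc j)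
  have "{0..<2 * int (Suc j)} = insert (2 * int j) (insert (2 * int j + 1) {0..<2 * int j})" by auto
  moreover have "step_config (2 * int j) = 1" "step_config (2 * int j + 1) = 0"
    using Suc.prems size by (auto simp: step_config_def torus_def)
  ultimately show ?case using Suc by simp
qed simp

lemma step_config_ergodic: "step_config \<in> ergodic N K"
proof -
  have split: "torus N = {0..<2 * int (N - K)} \<union> {2 * int (N - K)..<int N}"
    using size by (auto simp: torus_def)
  have "(\<Sum>x\<in>torus N. step_config x) = (N - K) + (\<Sum>x\<in>{2 * int (N - K)..<int N}. step_config x)"
    unfolding split by (subst sum.union_disjoint) (auto simp: sum_step_config)
  also have "(\<Sum>x\<in>{2 * int (N - K)..<int N}. step_config x) = (\<Sum>x\<in>{2 * int (N - K)..<int N}. 1)"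
    by (intro sum.cong) (auto simp: step_config_def torus_def)
  also have "(N - K) + \<dots> = K" using size by (simp add: nat_diff_distrib)
  finally have "step_config \<in> configs N K" by (auto simp: configs_def step_config_def)
  moreover have "step_config x + step_config (nxt x) \<ge> 1" if "x \<in> torus N" for x
    using that nxt_eq[OF that] nxt_prv_simps(1)[OF that] by (auto simp: step_config_def)
  ultimately show ?thesis by (auto simp: ergodic_def nxt_def)
qed

text \<open>The coefficient is a geometric sum of modulus
  \<open>sin (pi * (N - K) / K) / sin (pi / K)\<close>; Jordan's inequality bounds the numerator
  below, and \<open>sin x \<le> x\<close> the denominator above.\<close>

lemma amplitude_step_config: "2 / pi * num_moves \<le> amplitude step_config"
proof -
  let ?k = "N - K"
  let ?F = "hole_sum (step_config, phase step_config)"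
  have "?F = (\<Sum>x\<in>(\<lambda>i. 2 * int i + 1) ` {..<?k}. phase step_config x)"
    unfolding hole_sum_def
  proof (rule sum.mono_neutral_cong_right)
    show "\<forall>x\<in>torus N - (\<lambda>i. 2 * int i + 1) ` {..<?k}.
        (1 - of_nat (fst (step_config, phase step_config) x)) * snd (step_config, phase step_config) x = 0"
    proof
      fix x assume x: "x \<in> torus N - (\<lambda>i. 2 * int i + 1) ` {..<?k}"
      have "\<not> (odd x \<and> x < 2 * int ?k)"
      proof
        assume o: "odd x \<and> x < 2 * int ?k"
        then obtain i where "x = 2 * i + 1" by (auto elim: oddE)
        hence "x = 2 * int (nat i) + 1" "nat i < ?k" using o x by (auto simp: torus_def)
        thus False using x by blast
      qed
      thus "(1 - of_nat (fst (step_config, phase step_config) x)) * snd (step_config, phase step_config) x = 0"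
        using x by (auto simp: step_config_def)
    qed
  qed (use size in \<open>auto simp: torus_def step_config_def\<close>)
  also have "\<dots> = (\<Sum>i<?k. phase step_config (2 * int i + 1))"
    by (subst sum.reindex) (auto simp: inj_on_def)
  also have "\<dots> = (\<Sum>i<?k. \<omega> * \<omega> ^ i)"
  proof (intro sum.cong refl)
    fix i assume "i \<in> {..<?k}"
    moreover have "{0..2 * int i + 1} = {0..<2 * int (Suc i)}" by auto
    ultimately show "phase step_config (2 * int i + 1) = \<omega> * \<omega> ^ i"
      using sum_step_config[of "Suc i"] by (simp add: phase_def)
  qed
  finally have "(1 - \<omega>) * ?F = \<omega> * (1 - \<omega> ^ ?k)"
    by (simp add: sum_distrib_left[symmetric] one_diff_power_eq)
  hence "norm (1 - \<omega>) * norm ?F = norm (1 - \<omega> ^ ?k)"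
    by (metis \<omega>_cnj(3) mult_1 norm_mult)
  also have "\<omega> ^ ?k = cis (2 * (pi * real ?k / real K))" by (simp add: \<omega>_def Complex.DeMoivre mult_ac)
  also have "norm (1 - \<dots>) = 2 * \<bar>sin (pi * real ?k / real K)\<bar>" by (simp add: norm_one_minus_cis)
  finally have F: "sin (pi / real K) * amplitude step_config = \<bar>sin (pi * real ?k / real K)\<bar>"
    by (simp add: norm_one_minus_\<omega> amplitude_def)
  have K: "0 < real K" using size by simp
  have "2 * num_moves / real K \<le> sin (pi * num_moves / real K)"
  proof -
    \<comment> \<open>\<open>num_moves\<close> is the smaller of two numbers with sum
      \<open>K\<close>, which puts the argument in the range of \<open>sin_ge_chord\<close>.\<close>
    have "2 * num_moves \<le> real K" using real_num_moves by linarith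
    hence "2 * (pi * num_moves / real K) / pi \<le> sin (pi * num_moves / real K)"
      using K num_moves_ge_1 by (intro sin_ge_chord) (auto simp: field_simps)
    thus ?thesis by simp
  qed
  \<comment> \<open>If the minimum is \<open>2 * K - N\<close>, the two arguments add up to
    \<open>pi\<close>.\<close>
  also have "sin (pi * num_moves / real K) = sin (pi * real ?k / real K)"
  proof (cases "2 * K - N \<le> N - K")
    case True
    hence "pi * num_moves / real K = pi - pi * real ?k / real K"
      using K size by (simp add: num_moves_def of_nat_diff field_simps)
    thus ?thesis by simp
  qed (simp add: num_moves_def)
  also have "\<dots> \<le> sin (pi / real K) * amplitude step_config" using F by simp
  also have "\<dots> \<le> pi / real K * amplitude step_config"
    using sin_x_le_x[of "pi / real K"] by (intro mult_right_mono) (auto simp: amplitude_def)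
  finally show ?thesis using K by (simp add: field_simps)
qed

lemma mixing_lower_bound:
  assumes "2 \<le> s" "2 / s\<^sup>2 < 1 - \<epsilon>" "0 \<le> t" "4 \<le> N"
    and mixed: "\<And>\<eta>. \<eta> \<in> ergodic N K \<Longrightarrow> tv_dist (fep_law N \<eta> t) (fep_stationary N K) \<le> \<epsilon>"
  shows "(real K)\<^sup>2 / (8 * pi\<^sup>2) * ln num_moves - ln (pi * s) / (4 * pi\<^sup>2) * (real K)\<^sup>2 \<le> t"
proof -
  let ?P = num_moves
  \<comment> \<open>Threshold of \<open>s\<close> standard deviations: the equilibrium amplitude
    exceeds it with probability at most \<open>1 / s\<^sup>2\<close>.\<close>
  define a where "a = s * sqrt ?P"
  define m where "m = exp (- gap * t) * amplitude step_config"
  have P: "0 < ?P" using num_moves_ge_1 by simp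
  have a: "0 < a" "?P / a\<^sup>2 = 1 / s\<^sup>2" using P assms(1) by (auto simp: a_def power_mult_distrib)
  \<comment> \<open>Otherwise the mean at time \<open>t\<close> is at least \<open>a\<close> above
    the threshold, so the law at time \<open>t\<close> gives the event at most
    \<open>1 / s\<^sup>2\<close> and equilibrium at least \<open>1 - 1 / s\<^sup>2\<close>. Their
    distance would exceed \<open>\<epsilon>\<close>.\<close>
  have "m < 2 * a"
  proof (rule ccontr)
    assume "\<not> m < 2 * a"
    hence m: "a \<le> m - a" "a < m" using a by auto
    have "measure_pmf.prob (fep_law N step_config t) {\<eta>. amplitude \<eta> \<le> a} \<le> ?P / (m - a)\<^sup>2"
      using fep_law_tail[OF step_config_ergodic assms(3,4), of a] m by (simp add: m_def)
    also have "\<dots> \<le> ?P / a\<^sup>2" using a m P by (intro divide_left_mono power_mono) auto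
    finally have "1 - 2 / s\<^sup>2 \<le> tv_dist (fep_law N step_config t) (fep_stationary N K)"
      using tv_dist_ge[of "fep_stationary N K" "{\<eta>. amplitude \<eta> \<le> a}" "fep_law N step_config t"]
        stationary_tail[OF a(1)] a(2) by linarith
    thus False using mixed[OF step_config_ergodic] assms(2) by simp
  qed
  moreover have "exp (- gap * t) * (2 / pi * ?P) \<le> m"
    unfolding m_def using amplitude_step_config by (intro mult_left_mono) auto
  ultimately have "exp (- gap * t) * (2 / pi * ?P) < 2 * a" by linarith
  hence "exp (- gap * t) * ?P < pi * s * sqrt ?P" by (simp add: a_def field_simps)
  hence "(exp (- gap * t) * sqrt ?P) * sqrt ?P < (pi * s) * sqrt ?P"
    using P by (simp add: mult.assoc)
  hence "exp (- gap * t) * sqrt ?P < pi * s" using P by (subst (asm) mult_less_cancel_right_pos) auto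
  hence "ln (exp (- gap * t) * sqrt ?P) < ln (pi * s)"
    using P assms(1) by (subst ln_less_cancel_iff) auto
  hence "ln ?P / 2 - ln (pi * s) \<le> gap * t"
    using P by (simp add: ln_mult ln_sqrt)
  also have "\<dots> \<le> 4 * pi\<^sup>2 / (real K)\<^sup>2 * t" using gap_le assms(3) by (rule mult_right_mono)
  finally show ?thesis using size by (simp add: field_simps)
qed

end

theorem proposition3p5:
  fixes K :: "nat \<Rightarrow> nat" and P :: "nat \<Rightarrow> int"
  assumes K_range: "\<And>N. N \<ge> 3 \<Longrightarrow> real N / 2 < real (K N) \<and> K N < N"
    and P_def: "\<And>N. N \<ge> 3 \<Longrightarrow> P N = min (2 * int (K N) - int N) (int N - int (K N))"
    and P_lim: "filterlim P at_top sequentially"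
  shows "\<forall>\<epsilon>\<in>{0<..<1 :: real}. \<exists>C>0. \<forall>N\<ge>3.
           ereal ((real (K N))\<^sup>2 / (8 * pi\<^sup>2) * ln (real_of_int (P N)) - C * (real (K N))\<^sup>2)
             \<le> fep_mixing_time N (K N) \<epsilon>"
proof
  fix \<epsilon> :: real
  assume \<epsilon>: "\<epsilon> \<in> {0<..<1}"
  \<comment> \<open>This makes \<open>2 / s\<^sup>2\<close> equal to
    \<open>(1 - \<epsilon>) / 2\<close>.\<close>
  define s where "s = 2 / sqrt (1 - \<epsilon>)"
  define C where "C = ln (pi * s) / (4 * pi\<^sup>2)"
  have s: "2 \<le> s" "2 / s\<^sup>2 < 1 - \<epsilon>"
    using \<epsilon> by (auto simp: s_def power_divide field_simps)
  have "1 < pi * s" using s(1) pi_gt3 mult_strict_mono[of 1 pi 1 s] by simp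
  hence C: "0 < C" by (simp add: C_def)
  show "\<exists>C>0. \<forall>N\<ge>3.
           ereal ((real (K N))\<^sup>2 / (8 * pi\<^sup>2) * ln (real_of_int (P N)) - C * (real (K N))\<^sup>2)
             \<le> fep_mixing_time N (K N) \<epsilon>"
  proof (intro exI[of _ C] conjI allI impI C)
    fix N :: nat assume N: "3 \<le> N"
    interpret fep_component N "K N"
      using K_range[OF N] N by unfold_locales auto
    have P: "real_of_int (P N) = num_moves"
      using size unfolding P_def[OF N] real_num_moves by simp
    show "ereal ((real (K N))\<^sup>2 / (8 * pi\<^sup>2) * ln (real_of_int (P N)) - C * (real (K N))\<^sup>2)
       \<le> fep_mixing_time N (K N) \<epsilon>"
      unfolding fep_mixing_time_def
    proof (intro Inf_greatest, clarify)
      fix t :: real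
      assume t: "0 \<le> t" "\<forall>\<eta>\<in>ergodic N (K N). tv_dist (fep_law N \<eta> t) (fep_stationary N (K N)) \<le> \<epsilon>"
      have "(real (K N))\<^sup>2 / (8 * pi\<^sup>2) * ln num_moves - C * (real (K N))\<^sup>2 \<le> t"
      proof (cases "4 \<le> N")
        case True
        show ?thesis
          unfolding C_def using \<epsilon> s t True by (intro mixing_lower_bound[where \<epsilon> = \<epsilon>]) auto
      next
        case False
        \<comment> \<open>\<open>lift.c\<close> is too small here for \<open>mixing_lower_bound\<close>, but the logarithm vanishes.\<close>
        hence "num_moves = 1" using N size by (simp add: num_moves_def)
        moreover have "0 \<le> C * (real (K N))\<^sup>2" using C by simp
        ultimately show ?thesis using t(1) by simp
      qed
      thus "ereal ((real (K N))\<^sup>2 / (8 * pi\<^sup>2) * ln (real_of_int (P N)) - C * (real (K N))\<^sup>2) \<le> ereal t"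
        by (simp add: P)
    qed
  qed
qed

end
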